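(* Let $P=\{x\in[0,1]^n:Ax\le b\}$ with $A\in\mathbb R^{m\times n}$ nonnegative and $b\in\mathbb R^m$ positive, and let $k\ge1$ be an integer. Suppose there exists $\ell\in[n]$ such that all tiers $S$ generated by $\mathrm{BZ}'^k$ (applied to $P$) of size greater than $\ell$ are $P$-useless. Then $$\mathrm{BZ}'^k(P)\supseteq\mathrm{SA}'^{2\ell}(\mathcal O_k(P)).$$
   Context: **Notation.** Let $[n]=\{1,\dots,n\}$, $\mathcal F=\{0,1\}^n$, and let $\mathcal A=2^{\mathcal F}$ be the power set of $\mathcal F$. For $P\subseteq[0,1]^n$ let $K(P)=\{(\lambda,\lambda x)\in\mathbb R^{n+1}:\lambda\ge 0,\ x\in P\}$. For $S\subseteq[n]$, $t\in\{0,1\}$, let $S|_t=\{x\in\mathcal F: x_i=t\ \forall i\in S\}$ (so $\emptyset|_t=\mathcal F$) and $i|_t=\{i\}|_t$. For $U\subseteq[n]$ and an integer $r\ge0$ let $U|_{<r}=\{x\in\mathcal F:\sum_{i\in U}x_i\le r-1\}$. For $k\ge0$ let $\mathcal A_k=\{S|_1\cap T|_0:S,T\subseteq[n],\ S\cap T=\emptyset,\ |S|+|T|\le k\}$ and $\mathcal A_k^+=\{S|_1:S\subseteq[n],|S|\le k\}$. Matrices have rows and columns indexed by subfamilies of $\mathcal A$; $Ye_\alpha$ is the column of $Y$ indexed by $\alpha$. For a vector $y$ indexed by a family containing $\mathcal F$ and all $i|_1$, $\hat x(y)=(y_{\mathcal F},y_{1|_1},\dots,y_{n|_1})^\top$;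 for $x\in\mathbb R^n$, $\hat x=(1,x)\in\mathbb R^{n+1}$. Vectors indexed by $\mathcal A_1^+$ are identified with vectors in $\mathbb R^{n+1}$ via the order $\mathcal F,1|_1,\dots,n|_1$. **The operator $\mathrm{SA}'^k$ ($k\ge1$).** For $P\subseteq[0,1]^n$ let $\tilde{\mathrm{SA}}'^k(P)$ be the set of matrices $Y\in\mathbb R^{\mathcal A_1^+\times\mathcal A_k}$ such that: (1) $Y[\mathcal F,\mathcal F]=1$; (2) $Ye_\alpha\in K(P)$ for all $\alpha\in\mathcal A_k$; (3) for every $S|_1\cap T|_0\in\mathcal A_{k-1}$ and $j\in[n]\setminus(S\cup T)$: $Ye_{S|_1\cap T|_0\cap j|_1}+Ye_{S|_1\cap T|_0\cap j|_0}=Ye_{S|_1\cap T|_0}$; (4) $Y[\alpha,\beta]=0$ for all $\alpha\in\mathcal A_1^+,\beta\in\mathcal A_k$ with $\alpha\cap\beta=\emptyset$; (4') $Y[\alpha,\beta]=0$ for all $\alpha\in\mathcal A_1^+,\beta\in\mathcal A_k$ with $\mathrm{conv}(\alpha)\cap\mathrm{conv}(\beta)\cap P=\emptyset$; (5) $Y[\alpha_1,\beta_1]=Y[\alpha_2,\beta_2]$ for all $\alpha_1,\alpha_2\in\mathcal A_1^+$, $\beta_1,\beta_2\in\mathcal A_k$ with $\alpha_1\cap\beta_1=\alpha_2\cap\beta_2$. Then $\mathrm{SA}'^k(P)=\{x\in\mathbb R^n:\exists Y\in\tilde{\mathrm{SA}}'^k(P),\ Ye_{\mathcal F}=\hat x\}$.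 **The operator $\mathrm{BZ}'^k$ ($k\ge1$).** The input is $P=\{x\in[0,1]^n:Ax\le b\}$ as in the claim; the operator depends on the system $Ax\le b$. Let $A^i$ be the $i$-th row of $A$. A set $O\subseteq[n]$ is a $k$-small obstruction if for some $i\in[m]$: $O\subseteq\mathrm{supp}(A^i)$, $\sum_{j\in O}A^i_j>b_i$, and ($|O|\le k+1$ or $|O|\ge|\mathrm{supp}(A^i)|-(k+1)$). Let $\mathcal O_k$ be the collection of all $k$-small obstructions and $\mathcal O_k(P)=\{x\in P:\sum_{i\in O}x_i\le|O|-1\ \forall O\in\mathcal O_k\}$. Walls: $\mathcal W_k=\{\bigcup_{i,j\in[\ell],i\ne j}(O_i\cap O_j):O_1,\dots,O_\ell\in\mathcal O_k,\ 2\le\ell\le k+1\}\cup\{\{1\},\dots,\{n\}\}$. Tiers: $\mathcal T_k=\{S\subseteq[n]:\exists W_1,\dots,W_k\in\mathcal W_k,\ S\subseteq\bigcup_{j=1}^kW_j\}$. Let $\mathcal A'$ consist of, for each tier $S\in\mathcal T_k$: (a) $(S\setminus T)|_1\cap T|_0$ for all $T\subseteq S$ with $|T|\le k$; (b) $(S\setminus(T\cup U))|_1\cap T|_0\cap U|_{<|U|-(k-|T|)}$ for all $T,U\subseteq S$ with $U\cap T=\emptyset$, $|T|<k$, $|U|+|T|>k$. The sets in (a),(b) are the variables associated with the tier $S$. Let $\tilde{\mathrm{BZ}}'^k(P)$ be the set of symmetric real matrices $Y$ indexed by $\mathcal A'\times\mathcal A'$ such that: (BZ'1) $Y[\mathcal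 F,\mathcal F]=1$. (BZ'2) Every column $y$ of $Y$ satisfies: (i) $0\le y_\alpha\le y_{\mathcal F}$ for all $\alpha\in\mathcal A'$; (ii) $\hat x(y)\in K(\mathcal O_k(P))$; (iii) $y_{i|_1}+y_{i|_0}=y_{\mathcal F}$ for all $i\in[n]$; (iv) for each $\alpha\in\mathcal A'$ of the form $S|_1\cap T|_0$: $y_{i|_1}\ge y_\alpha$ for $i\in S$; $y_{i|_0}\ge y_\alpha$ for $i\in T$; $y_\alpha+y_{(S\cup\{i\})|_1\cap(T\setminus\{i\})|_0}=y_{S|_1\cap(T\setminus\{i\})|_0}$ for $i\in T$; $\sum_{i\in S}y_{i|_1}+\sum_{i\in T}y_{i|_0}-y_\alpha\le(|S|+|T|-1)y_{\mathcal F}$; (v) for each $\alpha\in\mathcal A'$ of the form $S|_1\cap T|_0\cap U|_{<r}$: $y_{i|_1}\ge y_\alpha$ for $i\in S$; $y_{i|_0}\ge y_\alpha$ for $i\in T$; $\sum_{i\in U}y_{i|_0}\ge(|U|-(r-1))y_\alpha$; $y_\alpha=y_{S|_1\cap T|_0}-\sum_{U'\subseteq U,|U'|\ge r}y_{(S\cup U')|_1\cap(T\cup(U\setminus U'))|_0}$. (BZ'3) $Y[\alpha,\beta]=0$ for all $\alpha,\beta\in\mathcal A'$ with $\mathrm{conv}(\alpha)\cap\mathrm{conv}(\beta)\cap P=\emptyset$. (BZ'4) $Y[\alpha_1,\beta_1]=Y[\alpha_2,\beta_2]$ whenever $\alpha_1,\beta_1,\alpha_2,\beta_2\in\mathcal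 A'$ and $\alpha_1\cap\beta_1=\alpha_2\cap\beta_2$. Then $\mathrm{BZ}'^k(P)=\{x\in\mathbb R^n:\exists Y\in\tilde{\mathrm{BZ}}'^k(P),\ \hat x(Ye_{\mathcal F})=\hat x\}$. **$P$-useless variables and tiers.** Suppose the columns of the lifted matrices are indexed by $\mathcal S'\subseteq\mathcal A$ (here $\mathcal S'=\mathcal A'$). If $\mathcal T=\{T_1,\dots,T_q\}\subseteq\mathcal S'$ satisfies (1) $\bigcup_{i=1}^qT_i\in\mathcal S'\setminus\mathcal T$ and (2) there is exactly one $j\in[q]$ with $P\cap\mathrm{conv}(T_j)\ne\emptyset$, then the sets $T_1,\dots,T_q$ are called $P$-useless. A tier $S$ is $P$-useless if all variables associated with $S$ are $P$-useless. *)

theory Defs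
  imports "HOL-Analysis.Analysis"
begin

text \<open>
  The index set \<open>[n]\<close> is a finite type \<open>'n\<close>, and \<open>[m]\<close> a finite type \<open>'m\<close>. Elements of \<open>\<F>\<close> are
  0/1-vectors in \<open>real^'n\<close>, so elements of \<open>\<A>\<close> are sets of real vectors and \<open>convex hull\<close> applies to
  them directly. The space \<open>\<real>\<^sup>n\<^sup>+\<^sup>1\<close> is \<open>real \<times> (real^'n)\<close>, with the homogenizing coordinate first.

  A matrix with rows and columns indexed by subfamilies of \<open>\<A>\<close> is a total function of two sets,
  row first; only its entries on the respective index families are ever constrained or used.
\<close>

definition cube01 :: "(real^'n) set" where
  "cube01 = {x. \<forall>i. x $ i \<in> {0, 1}}"

definition fixed :: "'n set \<Rightarrow> real \<Rightarrow> (real^'n) set" where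
  "fixed S t = {x \<in> cube01. \<forall>i\<in>S. x $ i = t}"

abbreviation ones :: "'n set \<Rightarrow> (real^'n) set" where
  "ones S \<equiv> fixed S 1"

abbreviation zeros :: "'n set \<Rightarrow> (real^'n) set" where
  "zeros S \<equiv> fixed S 0"

definition fewer :: "'n::finite set \<Rightarrow> nat \<Rightarrow> (real^'n) set" where
  "fewer U r = {x \<in> cube01. (\<Sum>i\<in>U. x $ i) \<le> real r - 1}"

definition hcone :: "(real^'n) set \<Rightarrow> (real \<times> (real^'n)) set" where
  "hcone P = {(c, c *\<^sub>R x) | c x. 0 \<le> c \<and> x \<in> P}"

definition hat :: "real^'n \<Rightarrow> real \<times> (real^'n)" where
  "hat x = (1, x)"

definition hat_of :: "((real^'n) set \<Rightarrow> real) \<Rightarrow> real \<times> (real^'n)" where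
  "hat_of y = (y cube01, (\<chi> i. y (ones {i})))"


section \<open>The operator SA'\<close>

definition sa_cols :: "nat \<Rightarrow> (real^'n::finite) set set" where
  "sa_cols k = {ones S \<inter> zeros T | S T. S \<inter> T = {} \<and> card S + card T \<le> k}"

definition sa_rows :: "nat \<Rightarrow> (real^'n::finite) set set" where
  "sa_rows k = {ones S | S. card S \<le> k}"

text \<open>A column indexed by \<open>sa_rows 1\<close> is identified with a vector of \<open>\<real>\<^sup>n\<^sup>+\<^sup>1\<close> through \<open>hat_of\<close>.\<close>

definition SA_lift ::
  "nat \<Rightarrow> (real^'n::finite) set \<Rightarrow> ((real^'n) set \<Rightarrow> (real^'n) set \<Rightarrow> real) set" where
  "SA_lift k P = {Y.
     Y cube01 cube01 = 1 \<and>
     (\<forall>\<alpha>\<in>sa_cols k. hat_of (\<lambda>\<gamma>. Y \<gamma> \<alpha>) \<in> hcone P) \<and>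
     (\<forall>S T j. ones S \<inter> zeros T \<in> sa_cols (k - 1) \<and> j \<notin> S \<union> T \<longrightarrow>
        (\<forall>\<gamma>\<in>sa_rows 1.
           Y \<gamma> (ones S \<inter> zeros T \<inter> ones {j}) + Y \<gamma> (ones S \<inter> zeros T \<inter> zeros {j})
             = Y \<gamma> (ones S \<inter> zeros T))) \<and>
     (\<forall>\<alpha>\<in>sa_rows 1. \<forall>\<beta>\<in>sa_cols k. \<alpha> \<inter> \<beta> = {} \<longrightarrow> Y \<alpha> \<beta> = 0) \<and>
     (\<forall>\<alpha>\<in>sa_rows 1. \<forall>\<beta>\<in>sa_cols k.
        convex hull \<alpha> \<inter> convex hull \<beta> \<inter> P = {} \<longrightarrow> Y \<alpha> \<beta> = 0) \<and>
     (\<forall>\<alpha>\<^sub>1\<in>sa_rows 1. \<forall>\<alpha>\<^sub>2\<in>sa_rows 1. \<forall>\<beta>\<^sub>1\<in>sa_cols k. \<forall>\<beta>\<^sub>2\<in>sa_cols k.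
        \<alpha>\<^sub>1 \<inter> \<beta>\<^sub>1 = \<alpha>\<^sub>2 \<inter> \<beta>\<^sub>2 \<longrightarrow> Y \<alpha>\<^sub>1 \<beta>\<^sub>1 = Y \<alpha>\<^sub>2 \<beta>\<^sub>2)}"

definition SA :: "nat \<Rightarrow> (real^'n::finite) set \<Rightarrow> (real^'n) set" where
  "SA k P = {x. \<exists>Y\<in>SA_lift k P. hat_of (\<lambda>\<gamma>. Y \<gamma> cube01) = hat x}"


section \<open>The operator BZ'\<close>

definition feasible :: "real^'n^'m \<Rightarrow> real^'m \<Rightarrow> (real^'n) set" where
  "feasible A b = {x. (\<forall>j. 0 \<le> x $ j \<and> x $ j \<le> 1) \<and> (\<forall>i. (A *v x) $ i \<le> b $ i)}"

definition row_supp :: "real^'n^'m \<Rightarrow> 'm \<Rightarrow> 'n set" where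
  "row_supp A i = {j. A $ i $ j \<noteq> 0}"

definition obstructions :: "real^'n^'m \<Rightarrow> real^'m \<Rightarrow> nat \<Rightarrow> 'n set set" where
  "obstructions A b k = {O'. \<exists>i. O' \<subseteq> row_supp A i \<and> (\<Sum>j\<in>O'. A $ i $ j) > b $ i \<and>
     (card O' \<le> k + 1 \<or> card (row_supp A i) \<le> card O' + (k + 1))}"

definition obstruction_relax :: "real^'n^'m \<Rightarrow> real^'m \<Rightarrow> nat \<Rightarrow> (real^'n) set" where
  "obstruction_relax A b k =
     {x \<in> feasible A b. \<forall>O'\<in>obstructions A b k. (\<Sum>i\<in>O'. x $ i) \<le> real (card O') - 1}"

text \<open>The obstructions generating a wall form a sequence and may repeat.\<close>

definition walls :: "real^'n^'m \<Rightarrow> real^'m \<Rightarrow> nat \<Rightarrow> 'n set set" where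
  "walls A b k =
     {(\<Union>i\<in>{1..l}. \<Union>j\<in>{1..l} - {i}. Os i \<inter> Os j) | (Os :: nat \<Rightarrow> 'n set) l.
        2 \<le> l \<and> l \<le> k + 1 \<and> (\<forall>i\<in>{1..l}. Os i \<in> obstructions A b k)}
     \<union> {{i} | i. True}"

definition tiers :: "real^'n^'m \<Rightarrow> real^'m \<Rightarrow> nat \<Rightarrow> 'n set set" where
  "tiers A b k = {S. \<exists>W :: nat \<Rightarrow> 'n set.
     (\<forall>j\<in>{1..k}. W j \<in> walls A b k) \<and> S \<subseteq> (\<Union>j\<in>{1..k}. W j)}"

text \<open>
  The natural-number subtractions in \<open>card U - (k - card T)\<close> do not truncate, because
  \<open>card T < k < card U + card T\<close>; in particular the bound is at least 1.
\<close>

definition tier_vars :: "nat \<Rightarrow> 'n::finite set \<Rightarrow> (real^'n) set set" where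
  "tier_vars k S =
     {ones (S - T) \<inter> zeros T | T. T \<subseteq> S \<and> card T \<le> k}
     \<union> {ones (S - (T \<union> U)) \<inter> zeros T \<inter> fewer U (card U - (k - card T)) | T U.
          T \<subseteq> S \<and> U \<subseteq> S \<and> U \<inter> T = {} \<and> card T < k \<and> card U + card T > k}"

definition bz_vars :: "real^'n^'m \<Rightarrow> real^'m \<Rightarrow> nat \<Rightarrow> (real^'n) set set" where
  "bz_vars A b k = (\<Union>S\<in>tiers A b k. tier_vars k S)"

text \<open>
  In the last two blocks, \<open>\<alpha>\<close> ranges over all elements of \<open>bz_vars\<close> that can be written in the given
  form with pairwise disjoint sets. Every entry of \<open>y\<close> mentioned is then again indexed by
  \<open>bz_vars\<close>; for overlapping sets the sum could run over the empty subset of the cube, which is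
  not an index.
\<close>

definition bz_column ::
  "real^'n^'m \<Rightarrow> real^'m \<Rightarrow> nat \<Rightarrow> ((real^'n) set \<Rightarrow> real) \<Rightarrow> bool" where
  "bz_column A b k y \<longleftrightarrow>
     (\<forall>\<alpha>\<in>bz_vars A b k. 0 \<le> y \<alpha> \<and> y \<alpha> \<le> y cube01) \<and>
     hat_of y \<in> hcone (obstruction_relax A b k) \<and>
     (\<forall>i. y (ones {i}) + y (zeros {i}) = y cube01) \<and>
     (\<forall>\<alpha>\<in>bz_vars A b k. \<forall>S T. S \<inter> T = {} \<and> \<alpha> = ones S \<inter> zeros T \<longrightarrow>
        (\<forall>i\<in>S. y (ones {i}) \<ge> y \<alpha>) \<and>
        (\<forall>i\<in>T. y (zeros {i}) \<ge> y \<alpha>) \<and>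
        (\<forall>i\<in>T. y \<alpha> + y (ones (S \<union> {i}) \<inter> zeros (T - {i})) = y (ones S \<inter> zeros (T - {i}))) \<and>
        (\<Sum>i\<in>S. y (ones {i})) + (\<Sum>i\<in>T. y (zeros {i})) - y \<alpha>
          \<le> (real (card S) + real (card T) - 1) * y cube01) \<and>
     (\<forall>\<alpha>\<in>bz_vars A b k. \<forall>S T U r.
        S \<inter> T = {} \<and> S \<inter> U = {} \<and> T \<inter> U = {} \<and> \<alpha> = ones S \<inter> zeros T \<inter> fewer U r \<longrightarrow>
        (\<forall>i\<in>S. y (ones {i}) \<ge> y \<alpha>) \<and>
        (\<forall>i\<in>T. y (zeros {i}) \<ge> y \<alpha>) \<and>
        (\<Sum>i\<in>U. y (zeros {i})) \<ge> (real (card U) - (real r - 1)) * y \<alpha> \<and>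
        y \<alpha> = y (ones S \<inter> zeros T)
          - (\<Sum>U'\<in>{U'. U' \<subseteq> U \<and> card U' \<ge> r}. y (ones (S \<union> U') \<inter> zeros (T \<union> (U - U')))))"

definition BZ_lift ::
  "real^'n^'m \<Rightarrow> real^'m \<Rightarrow> nat \<Rightarrow> ((real^'n) set \<Rightarrow> (real^'n) set \<Rightarrow> real) set" where
  "BZ_lift A b k = {Y.
     (\<forall>\<alpha>\<in>bz_vars A b k. \<forall>\<beta>\<in>bz_vars A b k. Y \<alpha> \<beta> = Y \<beta> \<alpha>) \<and>
     Y cube01 cube01 = 1 \<and>
     (\<forall>\<beta>\<in>bz_vars A b k. bz_column A b k (\<lambda>\<alpha>. Y \<alpha> \<beta>)) \<and>
     (\<forall>\<alpha>\<in>bz_vars A b k. \<forall>\<beta>\<in>bz_vars A b k.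
        convex hull \<alpha> \<inter> convex hull \<beta> \<inter> feasible A b = {} \<longrightarrow> Y \<alpha> \<beta> = 0) \<and>
     (\<forall>\<alpha>\<^sub>1\<in>bz_vars A b k. \<forall>\<beta>\<^sub>1\<in>bz_vars A b k. \<forall>\<alpha>\<^sub>2\<in>bz_vars A b k. \<forall>\<beta>\<^sub>2\<in>bz_vars A b k.
        \<alpha>\<^sub>1 \<inter> \<beta>\<^sub>1 = \<alpha>\<^sub>2 \<inter> \<beta>\<^sub>2 \<longrightarrow> Y \<alpha>\<^sub>1 \<beta>\<^sub>1 = Y \<alpha>\<^sub>2 \<beta>\<^sub>2)}"

definition BZ :: "real^'n^'m \<Rightarrow> real^'m \<Rightarrow> nat \<Rightarrow> (real^'n) set" where
  "BZ A b k = {x. \<exists>Y\<in>BZ_lift A b k. hat_of (\<lambda>\<alpha>. Y \<alpha> cube01) = hat x}"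


section \<open>Useless variables and tiers\<close>

definition useless_family ::
  "(real^'n) set \<Rightarrow> (real^'n) set set \<Rightarrow> (real^'n) set set \<Rightarrow> bool" where
  "useless_family P V \<T> \<longleftrightarrow>
     \<T> \<subseteq> V \<and> \<Union>\<T> \<in> V - \<T> \<and> (\<exists>!T. T \<in> \<T> \<and> P \<inter> convex hull T \<noteq> {})"

definition useless_var :: "(real^'n) set \<Rightarrow> (real^'n) set set \<Rightarrow> (real^'n) set \<Rightarrow> bool" where
  "useless_var P V \<alpha> \<longleftrightarrow> (\<exists>\<T>. useless_family P V \<T> \<and> \<alpha> \<in> \<T>)"

definition useless_tier :: "real^'n^'m \<Rightarrow> real^'m \<Rightarrow> nat \<Rightarrow> 'n set \<Rightarrow> bool" where
  "useless_tier A b k S \<longleftrightarrow>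
     (\<forall>\<alpha>\<in>tier_vars k S. useless_var (feasible A b) (bz_vars A b k) \<alpha>)"

end

theory Submission
  imports Defs
begin

text \<open>
  Let \<open>\<I>\<close> be the family of sets whose indicator vectors lie in \<open>P\<close>. Since \<open>A\<close> is nonnegative, it is an
  independence system. By condition (5), a matrix \<open>Y\<close> certifying membership in \<open>SA'\<^sup>2\<^sup>l\<close> is the same
  as a vector of moments of degree up to \<open>2l + 1\<close>, and Moebius inversion turns these moments into a
  signed measure on all subsets of \<open>[n]\<close>. It is carried by \<open>\<I>\<close> and nonnegative on every event that
  depends on at most \<open>2l + 1\<close> coordinates. Take as entry \<open>Y[\<alpha>, \<beta>]\<close> of the BZ' matrix the measure of
  \<open>\<alpha> \<inter> \<beta>\<close>. Symmetry, (BZ'3), (BZ'4) and all linear equations then hold automatically.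

  For the inequalities, uselessness of large tiers implies that within \<open>\<I>\<close> every variable depends on
  at most \<open>l\<close> coordinates, so the event \<open>\<alpha> \<inter> \<beta>\<close> depends on at most \<open>2l\<close> of them. Applied to the variables
  \<open>X|\<^sub>1 \<inter> T|\<^sub>0\<close>, this bounds \<open>|X| + |T|\<close> by \<open>l\<close> whenever \<open>X \<union> T\<close> lies in a tier, \<open>|T| \<le> k + 1\<close>, and
  \<open>X \<union> {t} \<in> \<I>\<close> for all \<open>t \<in> T\<close>. As zeros forced by \<open>X\<close> are free, every cell \<open>X|\<^sub>1 \<inter> T|\<^sub>0 \<inter> \<beta>\<close> with at most
  \<open>k + 2\<close> zeros has nonnegative measure, which is what the inequality for variables with \<open>U|\<^sub><\<^sub>r\<close> needs.
\<close>

section \<open>Signed measures on the subsets of a finite set\<close>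

text \<open>Moebius inversion on the Boolean lattice: once the sums are exchanged, the coefficient
  of \<open>g Z\<close> is an alternating sum over the interval from \<open>W\<close> to
  \<open>Z\<close>, which is zero unless \<open>Z = W\<close>.\<close>

lemma superset_sums_prescribed:
  fixes g :: "'n::finite set \<Rightarrow> real"
  defines "m \<equiv> \<lambda>X. \<Sum>Z | X \<subseteq> Z. (-1) ^ (card Z + card X) * g Z"
  shows "(\<Sum>X | W \<subseteq> X. m X) = g W"
proof -
  have inner: "(\<Sum>X | X \<subseteq> Z \<and> W \<subseteq> X. (-1) ^ card X) = (0::real)" if "W \<noteq> Z" for Z
  proof (cases "W \<subseteq> Z")
    case True
    with that have "W \<subset> Z" by blast
    then show ?thesis
      using card_subsupersets_even_odd[of Z W] by (intro sum_alternating_cancels) auto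
  next
    case False
    then have "{X. X \<subseteq> Z \<and> W \<subseteq> X} = {}" by blast
    then show ?thesis by (simp only: sum.empty)
  qed
  have "(\<Sum>X | W \<subseteq> X. m X)
      = (\<Sum>Z\<in>UNIV. \<Sum>X | X \<in> {X. W \<subseteq> X} \<and> X \<subseteq> Z. (-1) ^ (card Z + card X) * g Z)"
    unfolding m_def using sum.swap_restrict[of "{X. W \<subseteq> X}" UNIV
        "\<lambda>X Z. (-1) ^ (card Z + card X) * g Z" "\<lambda>X Z. X \<subseteq> Z"] by simp
  also have "\<dots> = (\<Sum>Z\<in>UNIV. if Z = W then g W else 0)"
  proof (rule sum.cong[OF refl])
    fix Z
    have "(\<Sum>X | X \<in> {X. W \<subseteq> X} \<and> X \<subseteq> Z. (-1) ^ (card Z + card X) * g Z)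
        = ((-1) ^ card Z * (\<Sum>X | X \<subseteq> Z \<and> W \<subseteq> X. (-1) ^ card X)) * g Z"
      by (simp add: power_add sum_distrib_left sum_distrib_right conj_commute)
    also have "\<dots> = (if Z = W then g W else 0)"
    proof (cases "Z = W")
      case True
      then have "{X. X \<subseteq> Z \<and> W \<subseteq> X} = {W}" by blast
      with True show ?thesis by (simp flip: power_add)
    next
      case False
      then show ?thesis using inner[of Z] by auto
    qed
    finally show "(\<Sum>X | X \<in> {X. W \<subseteq> X} \<and> X \<subseteq> Z. (-1) ^ (card Z + card X) * g Z)
        = (if Z = W then g W else 0)" .
  qed
  finally show ?thesis by simp
qed

section \<open>Integration against a signed measure\<close>

definition E :: "('n::finite set \<Rightarrow> real) \<Rightarrow> ('n set \<Rightarrow> real) \<Rightarrow> real" where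
  "E m h = (\<Sum>X\<in>UNIV. m X * h X)"

lemma E_add: "E m (\<lambda>X. f X + g X) = E m f + E m g"
  by (simp add: E_def distrib_left sum.distrib)

lemma E_diff: "E m (\<lambda>X. f X - g X) = E m f - E m g"
  by (simp add: E_def right_diff_distrib sum_subtractf)

lemma E_cmult: "E m (\<lambda>X. c * f X) = c * E m f"
  by (simp add: E_def sum_distrib_left mult_ac)

lemma E_sum: "E m (\<lambda>X. \<Sum>i\<in>A. f i X) = (\<Sum>i\<in>A. E m (f i))"
  by (simp add: E_def sum_distrib_left sum.swap[of _ A])

lemma E_of_bool: "E m (\<lambda>X. of_bool (P X)) = (\<Sum>X | P X. m X)"
  by (simp add: E_def sum.If_cases of_bool_def if_distrib cong: if_cong)

lemma E_split:
  "E m h = (\<Sum>W\<in>Pow R. E m (\<lambda>X. of_bool (X \<inter> R = W) * h X))"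
proof -
  have "h X = (\<Sum>W\<in>Pow R. of_bool (X \<inter> R = W) * h X)" for X
  proof -
    have "(\<Sum>W\<in>Pow R. of_bool (X \<inter> R = W) * h X) = (\<Sum>W\<in>Pow R. if X \<inter> R = W then h X else 0)"
      by (rule sum.cong) auto
    then show ?thesis by simp
  qed
  then have "E m h = E m (\<lambda>X. \<Sum>W\<in>Pow R. of_bool (X \<inter> R = W) * h X)" by presburger
  then show ?thesis by (simp only: E_sum)
qed

text \<open>Dependence is tested only on \<open>I\<close>, where the measure lives, so an event may
  depend on far fewer coordinates than its formula mentions.\<close>

definition depends :: "'n set set \<Rightarrow> 'n set \<Rightarrow> ('n set \<Rightarrow> 'b) \<Rightarrow> bool" where
  "depends I R f \<longleftrightarrow> (\<forall>X\<in>I. f X = f (X \<inter> R))"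

lemma dependsD: "depends I R f \<Longrightarrow> X \<in> I \<Longrightarrow> f (X \<inter> R) = f X"
  by (simp add: depends_def)

text \<open>A signed measure on a downward closed family that passes for a genuine measure in every
  test of at most \<open>d\<close> coordinates.\<close>

locale pseudomeasure =
  fixes m :: "'n::finite set \<Rightarrow> real" and I :: "'n set set" and d :: nat
  assumes I_down: "X \<in> I \<Longrightarrow> Z \<subseteq> X \<Longrightarrow> Z \<in> I"
    and supp: "X \<notin> I \<Longrightarrow> m X = 0"
    and cell_nonneg: "S \<inter> T = {} \<Longrightarrow> card S + card T \<le> d \<Longrightarrow> 0 \<le> (\<Sum>X | S \<subseteq> X \<and> X \<inter> T = {}. m X)"
begin

lemma E_cong: "(\<And>X. X \<in> I \<Longrightarrow> f X = g X) \<Longrightarrow> E m f = E m g"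
  unfolding E_def using supp by (intro sum.cong) (metis mult_eq_0_iff | simp)+

lemma depends_mono: "depends I R f \<Longrightarrow> R \<subseteq> R' \<Longrightarrow> depends I R' f"
  unfolding depends_def by (metis I_down Int_assoc Int_lower1 inf.absorb_iff2)

text \<open>Splitting by the trace on \<open>R\<close> writes the integral as a combination of cells
  of at most \<open>d\<close> literals with coefficients \<open>h W\<close>. A trace
  \<open>W\<close> outside \<open>I\<close> carries no mass, so the sign of \<open>h\<close> matters
  only on \<open>I\<close>.\<close>

lemma E_nonneg:
  assumes R: "card R \<le> d" and dep: "depends I R h"
    and nn: "\<And>X. X \<in> I \<Longrightarrow> X \<subseteq> R \<Longrightarrow> 0 \<le> h X"
  shows "0 \<le> E m h"
proof -
  have "E m h = (\<Sum>W\<in>Pow R. E m (\<lambda>X. of_bool (X \<inter> R = W) * h X))"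
    by (rule E_split)
  also have "\<dots> = (\<Sum>W\<in>Pow R. h W * (\<Sum>X | W \<subseteq> X \<and> X \<inter> (R - W) = {}. m X))"
  proof (rule sum.cong[OF refl])
    fix W assume W: "W \<in> Pow R"
    have "E m (\<lambda>X. of_bool (X \<inter> R = W) * h X)
        = E m (\<lambda>X. h W * of_bool (W \<subseteq> X \<and> X \<inter> (R - W) = {}))"
    proof (rule E_cong)
      fix X assume "X \<in> I"
      moreover have "X \<inter> R = W \<longleftrightarrow> W \<subseteq> X \<and> X \<inter> (R - W) = {}" using W by blast
      ultimately show "of_bool (X \<inter> R = W) * h X
          = h W * of_bool (W \<subseteq> X \<and> X \<inter> (R - W) = {})"
        using dependsD[OF dep, of X] by auto
    qed
    then show "E m (\<lambda>X. of_bool (X \<inter> R = W) * h X)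
        = h W * (\<Sum>X | W \<subseteq> X \<and> X \<inter> (R - W) = {}. m X)"
      by (simp only: E_cmult E_of_bool)
  qed
  also have "\<dots> \<ge> 0"
  proof (rule sum_nonneg)
    fix W assume "W \<in> Pow R"
    then have W: "W \<subseteq> R" by simp
    show "0 \<le> h W * (\<Sum>X | W \<subseteq> X \<and> X \<inter> (R - W) = {}. m X)"
    proof (cases "W \<in> I")
      case True
      have "card W + card (R - W) = card R"
        using W by (metis card_Un_disjoint Diff_disjoint Diff_partition finite)
      then show ?thesis using True W nn R by (intro mult_nonneg_nonneg cell_nonneg) auto
    next
      case False
      then have "(\<Sum>X | W \<subseteq> X \<and> X \<inter> (R - W) = {}. m X) = 0"
        using I_down supp by (intro sum.neutral) blast
      then show ?thesis by simp
    qed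
  qed
  finally show ?thesis .
qed

lemma E_nonneg_event:
  assumes "card R \<le> d" "depends I R P"
  shows "0 \<le> E m (\<lambda>X. of_bool (P X))"
  using assms by (intro E_nonneg[of R]) (auto simp: depends_def)

end

text \<open>
  Query the elements of \<open>U\<close> one after another and stop at the \<open>q\<close>-th zero; the cells occurring in
  this decision tree, and their intersections with one further zero, have at most \<open>q + 1\<close> zeros.
\<close>

lemma expected_zeros_lower_bound:
  fixes m :: "'n::finite set \<Rightarrow> real"
  assumes "\<And>X Z. X \<subseteq> U \<Longrightarrow> Z \<subseteq> U \<Longrightarrow> X \<inter> Z = {} \<Longrightarrow> card Z \<le> q + 1 \<Longrightarrow>
      0 \<le> E m (\<lambda>W. of_bool (X \<subseteq> W \<and> W \<inter> Z = {}))"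
  shows "real q * E m (\<lambda>W. of_bool (q \<le> card (U - W))) \<le> (\<Sum>i\<in>U. E m (\<lambda>W. of_bool (i \<notin> W)))"
  using finite[of U] assms
proof (induction U arbitrary: m q rule: finite_induct)
  case empty
  then show ?case by (cases q) (simp_all add: E_def)
next
  case (insert u U m q)
  show ?case
  proof (cases q)
    case 0
    have "0 \<le> E m (\<lambda>W. of_bool (i \<notin> W))" if "i \<in> insert u U" for i
      using insert.prems[of "{}" "{i}"] that 0 by simp
    then show ?thesis using 0 by (auto intro!: sum_nonneg)
  next
    case (Suc p)
    \<comment> \<open>The first query splits the measure: \<open>m1\<close> lives on
      \<open>u \<in> W\<close> and still awaits \<open>q\<close> zeros, \<open>m0\<close> lives on
      \<open>u \<notin> W\<close> and awaits only \<open>p\<close>.\<close>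
    define m1 where "m1 = (\<lambda>W. if u \<in> W then m W else 0)"
    define m0 where "m0 = (\<lambda>W. if u \<in> W then 0 else m W)"
    have E1: "E m1 (\<lambda>W. of_bool (P W)) = E m (\<lambda>W. of_bool (u \<in> W \<and> P W))" for P
      unfolding E_def m1_def by (rule sum.cong) auto
    have E0: "E m0 (\<lambda>W. of_bool (P W)) = E m (\<lambda>W. of_bool (u \<notin> W \<and> P W))" for P
      unfolding E_def m0_def by (rule sum.cong) auto
    have EE: "E m (\<lambda>W. of_bool (P W)) = E m1 (\<lambda>W. of_bool (P W)) + E m0 (\<lambda>W. of_bool (P W))" for P
      unfolding E1 E0 E_add[symmetric] by (rule arg_cong[where f="E m"]) auto
    have IH1: "real q * E m1 (\<lambda>W. of_bool (q \<le> card (U - W)))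
        \<le> (\<Sum>i\<in>U. E m1 (\<lambda>W. of_bool (i \<notin> W)))"
    proof (rule insert.IH)
      fix X Z assume XZ: "X \<subseteq> U" "Z \<subseteq> U" "X \<inter> Z = {}" "card Z \<le> q + 1"
      have "0 \<le> E m (\<lambda>W. of_bool (insert u X \<subseteq> W \<and> W \<inter> Z = {}))"
        using XZ insert.hyps by (intro insert.prems) auto
      then show "0 \<le> E m1 (\<lambda>W. of_bool (X \<subseteq> W \<and> W \<inter> Z = {}))"
        unfolding E1 by (simp add: conj_assoc)
    qed
    \<comment> \<open>The zero at \<open>u\<close> is charged here: of the
      \<open>q + 1 = p + 2\<close> zeros allowed, \<open>p + 1\<close> remain for
      \<open>Z\<close>.\<close>
    have zcell: "0 \<le> E m0 (\<lambda>W. of_bool (X \<subseteq> W \<and> W \<inter> Z = {}))"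
      if XZ: "X \<subseteq> U" "Z \<subseteq> U" "X \<inter> Z = {}" "card Z \<le> p + 1" for X Z
    proof -
      have "0 \<le> E m (\<lambda>W. of_bool (X \<subseteq> W \<and> W \<inter> insert u Z = {}))"
        using XZ insert.hyps Suc
        by (intro insert.prems) (auto simp: card_insert_if)
      moreover have "(X \<subseteq> W \<and> W \<inter> insert u Z = {}) = (u \<notin> W \<and> X \<subseteq> W \<and> W \<inter> Z = {})" for W
        by blast
      ultimately show ?thesis unfolding E0 by simp
    qed
    have IH0: "real p * E m0 (\<lambda>W. of_bool (p \<le> card (U - W)))
        \<le> (\<Sum>i\<in>U. E m0 (\<lambda>W. of_bool (i \<notin> W)))"
      by (rule insert.IH) (rule zcell)
    \<comment> \<open>The zero at \<open>u\<close> contributes the total mass of \<open>m0\<close>,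
      but only the part with at least \<open>p\<close> further zeros has to be paid for. The surplus
      is nonnegative because its cells have fewer than \<open>p\<close> zeros.\<close>
    have few: "0 \<le> E m0 (\<lambda>W. of_bool (\<not> p \<le> card (U - W)))"
    proof -
      have "E m0 (\<lambda>W. of_bool (\<not> p \<le> card (U - W)))
          = (\<Sum>V\<in>Pow U. E m0 (\<lambda>W. of_bool (W \<inter> U = V) * of_bool (\<not> p \<le> card (U - W))))"
        by (rule E_split)
      also have "\<dots> \<ge> 0"
      proof (rule sum_nonneg)
        fix V assume V: "V \<in> Pow U"
        have eq: "W \<inter> U = V \<longleftrightarrow> V \<subseteq> W \<and> W \<inter> (U - V) = {}" for W using V by blast
        have *: "of_bool (W \<inter> U = V) * of_bool (\<not> p \<le> card (U - W))
            = of_bool (\<not> p \<le> card (U - V)) * (of_bool (V \<subseteq> W \<and> W \<inter> (U - V) = {}) :: real)" for W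
        proof -
          have "U - W = U - V" if "W \<inter> U = V" using that by blast
          then show ?thesis unfolding eq[symmetric] by auto
        qed
        show "0 \<le> E m0 (\<lambda>W. of_bool (W \<inter> U = V) * of_bool (\<not> p \<le> card (U - W)))"
          unfolding * E_cmult using zcell[of V "U - V"] V by auto
      qed
      finally show ?thesis .
    qed
    have tot: "E m0 (\<lambda>W. 1) = E m0 (\<lambda>W. of_bool (p \<le> card (U - W)))
        + E m0 (\<lambda>W. of_bool (\<not> p \<le> card (U - W)))"
      unfolding E_add[symmetric] by (rule arg_cong[where f="E m0"]) auto
    have "card (insert u U - W) = (if u \<in> W then card (U - W) else Suc (card (U - W)))" for W
      using insert.hyps by (simp add: insert_Diff_if)
    then have L: "E m (\<lambda>W. of_bool (q \<le> card (insert u U - W)))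
        = E m1 (\<lambda>W. of_bool (q \<le> card (U - W))) + E m0 (\<lambda>W. of_bool (p \<le> card (U - W)))"
      unfolding E1 E0 E_add[symmetric] using Suc
      by (intro arg_cong[where f="E m"]) auto
    have "E m (\<lambda>W. of_bool (u \<notin> W)) = E m0 (\<lambda>W. 1)"
      using E0[of "\<lambda>_. True"] by simp
    then have R: "(\<Sum>i\<in>insert u U. E m (\<lambda>W. of_bool (i \<notin> W)))
        = E m0 (\<lambda>W. 1) + ((\<Sum>i\<in>U. E m1 (\<lambda>W. of_bool (i \<notin> W))) + (\<Sum>i\<in>U. E m0 (\<lambda>W. of_bool (i \<notin> W))))"
      using insert.hyps EE by (simp add: sum.distrib)
    show ?thesis unfolding L R
      using IH1 IH0 few tot Suc by (simp add: algebra_simps)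
  qed
qed

section \<open>From Sherali-Adams matrices to signed measures\<close>

definition ind :: "'n set \<Rightarrow> real^'n" where
  "ind X = (\<chi> i. of_bool (i \<in> X))"

text \<open>Translates events in the cube into set families; points of \<open>V\<close> outside the
  cube are ignored.\<close>

definition verts :: "(real^'n) set \<Rightarrow> 'n set set" where
  "verts V = {X. ind X \<in> V}"

lemma ind_nth [simp]: "ind X $ i = of_bool (i \<in> X)"
  by (simp add: ind_def)

lemma ind_in_cube01 [simp]: "ind X \<in> cube01"
  by (simp add: cube01_def)

lemma cube01_eq_range_ind: "cube01 = range ind"
proof
  show "cube01 \<subseteq> range ind"
  proof
    fix x :: "real^'n" assume "x \<in> cube01"
    then have "x = ind {i. x $ i = 1}" by (auto simp: vec_eq_iff cube01_def)
    then show "x \<in> range ind" by blast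
  qed
qed auto

lemma verts_ones [simp]: "X \<in> verts (ones S) \<longleftrightarrow> S \<subseteq> X"
  by (auto simp: verts_def fixed_def)

lemma verts_zeros [simp]: "X \<in> verts (zeros T) \<longleftrightarrow> X \<inter> T = {}"
  by (auto simp: verts_def fixed_def)

lemma verts_fewer [simp]: "X \<in> verts (fewer U r) \<longleftrightarrow> card (X \<inter> U) < r"
proof -
  have "(\<Sum>i\<in>U. ind X $ i) = real (card (X \<inter> U))"
    by (simp add: of_bool_def sum.If_cases Int_commute)
  then have "X \<in> verts (fewer U r) \<longleftrightarrow> real (card (X \<inter> U)) \<le> real r - 1"
    by (simp add: verts_def fewer_def)
  then show ?thesis by linarith
qed

lemma verts_cube01 [simp]: "verts cube01 = UNIV"
  by (auto simp: verts_def)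

lemma verts_Int [simp]: "verts (V \<inter> W) = verts V \<inter> verts W"
  by (auto simp: verts_def)

lemma fixed_empty [simp]: "fixed {} t = cube01"
  by (simp add: fixed_def)

lemma fixed_subset_cube01: "fixed S t \<subseteq> cube01"
  by (auto simp: fixed_def)

lemma cube01_Int_fixed [simp]: "cube01 \<inter> fixed S t = fixed S t" "fixed S t \<inter> cube01 = fixed S t"
  using fixed_subset_cube01 by blast+

lemma fixed_Int_fixed: "fixed S t \<inter> fixed T t = fixed (S \<union> T) t"
  by (auto simp: fixed_def)

lemma verts_hull: "X \<in> verts V \<Longrightarrow> ind X \<in> convex hull V"
  by (simp add: verts_def hull_inc)

text \<open>The normalized sum is the convex combination of \<open>x\<close> and \<open>y\<close>
  with weights proportional to \<open>c\<close> and \<open>d\<close>; if both vanish, the sum is the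
  origin again.\<close>

lemma hcone_add:
  assumes "convex Q" "u \<in> hcone Q" "v \<in> hcone Q"
  shows "u + v \<in> hcone Q"
proof -
  obtain c x where u: "u = (c, c *\<^sub>R x)" "0 \<le> c" "x \<in> Q" using assms by (auto simp: hcone_def)
  obtain d y where v: "v = (d, d *\<^sub>R y)" "0 \<le> d" "y \<in> Q" using assms by (auto simp: hcone_def)
  show ?thesis
  proof (cases "c + d = 0")
    case True
    with u v have "c = 0" "d = 0" by auto
    with u v assms show ?thesis by simp
  next
    case False
    let ?z = "(c / (c + d)) *\<^sub>R x + (d / (c + d)) *\<^sub>R y"
    have "?z \<in> Q" using u v False assms(1)
      by (intro convexD) (auto simp flip: add_divide_distrib)
    moreover have "u + v = (c + d, (c + d) *\<^sub>R ?z)"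
      using u v False by (simp add: scaleR_add_right)
    ultimately show ?thesis using u v unfolding hcone_def by fastforce
  qed
qed

text \<open>Nonemptiness of \<open>Q\<close> puts the origin into the cone, which accounts for the
  empty sum.\<close>

lemma hcone_sum:
  assumes "convex Q" "Q \<noteq> {}" "\<And>a. a \<in> A \<Longrightarrow> f a \<in> hcone Q"
  shows "sum f A \<in> hcone Q"
  using assms(3)
proof (induction A rule: infinite_finite_induct)
  case (insert a A)
  then show ?case using assms(1) by (simp add: hcone_add)
qed (use assms(2) in \<open>auto simp: hcone_def zero_prod_def\<close>)

text \<open>The family \<open>I\<close> is kept abstract; \<open>QI\<close> asks that it contain
  every set of coordinates that equal 1 at some point of \<open>Q\<close>. Columns carry up to
  \<open>d\<close> literals and rows at most one more, whence the degree
  \<open>d + 1\<close>.\<close>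

lemma SA_lift_pseudomeasure:
  fixes Q :: "(real^'n::finite) set" and d :: nat
  assumes Y: "Y \<in> SA_lift d Q" and d: "1 \<le> d"
    and Q01: "\<And>x j. x \<in> Q \<Longrightarrow> 0 \<le> x $ j \<and> x $ j \<le> 1"
    and QI: "\<And>x Z. x \<in> Q \<Longrightarrow> (\<And>i. i \<in> Z \<Longrightarrow> x $ i = 1) \<Longrightarrow> Z \<in> I"
    and I_down: "\<And>X Z. X \<in> I \<Longrightarrow> Z \<subseteq> X \<Longrightarrow> Z \<in> I"
  obtains m where "pseudomeasure m I (d + 1)"
    and "\<And>S X T. card S \<le> 1 \<Longrightarrow> X \<inter> T = {} \<Longrightarrow> card X + card T \<le> d \<Longrightarrow>
      Y (ones S) (ones X \<inter> zeros T) = E m (\<lambda>W. of_bool (S \<union> X \<subseteq> W \<and> W \<inter> T = {}))"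
proof -
  note Yc = Y[unfolded SA_lift_def mem_Collect_eq, THEN conjunct2]
  have cone: "hat_of (\<lambda>\<gamma>. Y \<gamma> \<alpha>) \<in> hcone Q" if "\<alpha> \<in> sa_cols d" for \<alpha>
    using Yc[THEN conjunct1] that by blast
  have split: "Y \<gamma> (ones S \<inter> zeros T \<inter> ones {j}) + Y \<gamma> (ones S \<inter> zeros T \<inter> zeros {j})
      = Y \<gamma> (ones S \<inter> zeros T)"
    if "ones S \<inter> zeros T \<in> sa_cols (d - 1)" "j \<notin> S \<union> T" "\<gamma> \<in> sa_rows 1" for S T j \<gamma>
    using Yc[THEN conjunct2, THEN conjunct1, rule_format, of S T j \<gamma>] that by fast
  have null: "Y \<alpha> \<beta> = 0" if "\<alpha> \<in> sa_rows 1" "\<beta> \<in> sa_cols d"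
    "convex hull \<alpha> \<inter> convex hull \<beta> \<inter> Q = {}" for \<alpha> \<beta>
    using Yc[THEN conjunct2, THEN conjunct2, THEN conjunct2, THEN conjunct1, THEN bspec, THEN bspec] that
    by blast
  have cong: "Y \<alpha> \<beta> = Y \<alpha>' \<beta>'" if "\<alpha> \<in> sa_rows 1" "\<alpha>' \<in> sa_rows 1" "\<beta> \<in> sa_cols d"
    "\<beta>' \<in> sa_cols d" "\<alpha> \<inter> \<beta> = \<alpha>' \<inter> \<beta>'" for \<alpha> \<beta> \<alpha>' \<beta>'
    using Yc[THEN conjunct2, THEN conjunct2, THEN conjunct2, THEN conjunct2,
        THEN bspec, THEN bspec, THEN bspec, THEN bspec] that
    by blast
  have row: "ones S \<in> sa_rows 1" if "card S \<le> 1" for S :: "'n set"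
    using that by (auto simp: sa_rows_def)
  have col: "ones X \<inter> zeros T \<in> sa_cols e" if "X \<inter> T = {}" "card X + card T \<le> e"
    for X T :: "'n set" and e
    using that by (auto simp: sa_cols_def)
  have col1: "ones X \<in> sa_cols e" if "card X \<le> e" for X :: "'n set" and e
    using col[of X "{}" e] that by simp
  have ones_conv: "x $ i = 1" if "x \<in> convex hull (ones S)" "i \<in> S" for x :: "real^'n" and i S
  proof -
    have "convex {x :: real^'n. x $ i = 1}"
      by (auto simp: convex_def algebra_simps)
    moreover have "ones S \<subseteq> {x. x $ i = 1}" using that(2) by (auto simp: fixed_def)
    ultimately have "convex hull (ones S) \<subseteq> {x. x $ i = 1}" by (simp add: hull_minimal)
    with that(1) show ?thesis by blast
  qed

  \<comment> \<open>By condition (5) the entry at \<open>ones S\<close> and \<open>ones X\<close>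
    depends only on the union of \<open>S\<close> and \<open>X\<close>, so any choice of a
    representation gives the same moment \<open>g Z\<close>. Sets with more than
    \<open>d + 1\<close> elements have no representation and get moment 0.\<close>
  define repr where "repr = (\<lambda>Z p. card (fst p) \<le> 1 \<and> card (snd p) \<le> d \<and> fst p \<union> snd p = (Z :: 'n set))"
  define g where "g = (\<lambda>Z. if \<exists>p. repr Z p then let p = SOME p. repr Z p
      in Y (ones (fst p)) (ones (snd p)) else 0)"
  have gY: "Y (ones S) (ones X) = g (S \<union> X)" if "card S \<le> 1" "card X \<le> d" for S X
  proof -
    have ex: "repr (S \<union> X) (S, X)" using that by (simp add: repr_def)
    define p where "p = (SOME p. repr (S \<union> X) p)"
    have p: "repr (S \<union> X) p" unfolding p_def using ex by (rule someI)
    have "Y (ones S) (ones X) = Y (ones (fst p)) (ones (snd p))"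
      using p that by (intro cong row col1) (auto simp: repr_def fixed_Int_fixed)
    then show ?thesis unfolding g_def p_def Let_def using ex by auto
  qed
  \<comment> \<open>A point of \<open>Q\<close> in both hulls would be 1 on all of \<open>Z\<close>
    and so put \<open>Z\<close> into \<open>I\<close>; hence condition (4') makes the entry
    vanish.\<close>
  have g0: "g Z = 0" if "Z \<notin> I" for Z
  proof (cases "\<exists>p. repr Z p")
    case True
    then obtain S X where SX: "card S \<le> 1" "card X \<le> d" "S \<union> X = Z" by (auto simp: repr_def)
    have "convex hull (ones S) \<inter> convex hull (ones X) \<inter> Q = {}"
    proof (rule ccontr)
      assume "convex hull (ones S) \<inter> convex hull (ones X) \<inter> Q \<noteq> {}"
      then obtain x where x: "x \<in> convex hull (ones S)" "x \<in> convex hull (ones X)" "x \<in> Q" by blast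
      have "Z \<in> I" using x(3) by (rule QI) (use x ones_conv SX(3) in blast)
      with that show False by blast
    qed
    then have "Y (ones S) (ones X) = 0" by (rule null[OF row[OF SX(1)] col1[OF SX(2)]])
    then show ?thesis using gY[OF SX(1,2)] SX(3) by simp
  qed (simp add: g_def)

  define m where "m = (\<lambda>X. \<Sum>Z | X \<subseteq> Z. (-1) ^ (card Z + card X) * g Z)"
  have Em: "E m (\<lambda>W. of_bool (Z \<subseteq> W)) = g Z" for Z
    unfolding E_of_bool m_def by (rule superset_sums_prescribed)
  have m0: "m X = 0" if "X \<notin> I" for X
  proof -
    have "g Z = 0" if "X \<subseteq> Z" for Z using that \<open>X \<notin> I\<close> I_down g0 by blast
    then show ?thesis by (simp add: m_def)
  qed

  \<comment> \<open>Condition (3) trades a zero at \<open>j\<close> for the difference between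
    leaving \<open>j\<close> free and setting it to 1; the latter enlarges \<open>X\<close>, which
    must therefore vary.\<close>
  have key: "Y (ones S) (ones X \<inter> zeros T) = E m (\<lambda>W. of_bool (S \<union> X \<subseteq> W \<and> W \<inter> T = {}))"
    if "card S \<le> 1" "X \<inter> T = {}" "card X + card T \<le> d" for S X T
    using finite[of T] that
  proof (induction T arbitrary: X rule: finite_induct)
    case empty
    then show ?case using gY[of S X] Em[of "S \<union> X"] by simp
  next
    case (insert j T X)
    have c: "card X + card T + 1 \<le> d" using insert by simp
    have "Y (ones S) (ones X \<inter> zeros T \<inter> ones {j}) + Y (ones S) (ones X \<inter> zeros T \<inter> zeros {j})
      = Y (ones S) (ones X \<inter> zeros T)"
      using insert.hyps insert.prems c by (intro split row col) auto
    moreover have "ones X \<inter> zeros T \<inter> ones {j} = ones (insert j X) \<inter> zeros T"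
      by (auto simp: fixed_def)
    moreover have "ones X \<inter> zeros T \<inter> zeros {j} = ones X \<inter> zeros (insert j T)"
      by (auto simp: fixed_def)
    moreover have "Y (ones S) (ones X \<inter> zeros T) = E m (\<lambda>W. of_bool (S \<union> X \<subseteq> W \<and> W \<inter> T = {}))"
      using insert.prems c by (intro insert.IH) auto
    moreover have "Y (ones S) (ones (insert j X) \<inter> zeros T)
        = E m (\<lambda>W. of_bool (S \<union> insert j X \<subseteq> W \<and> W \<inter> T = {}))"
      using insert.prems insert.hyps c by (intro insert.IH) (auto simp: card_insert_if)
    ultimately have "Y (ones S) (ones X \<inter> zeros (insert j T))
      = E m (\<lambda>W. of_bool (S \<union> X \<subseteq> W \<and> W \<inter> T = {}))
        - E m (\<lambda>W. of_bool (S \<union> insert j X \<subseteq> W \<and> W \<inter> T = {}))" by simp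
    also have "\<dots> = E m (\<lambda>W. of_bool (S \<union> X \<subseteq> W \<and> W \<inter> insert j T = {}))"
      unfolding E_diff[symmetric] by (rule arg_cong[where f="E m"]) auto
    finally show ?case .
  qed

  \<comment> \<open>A column is a nonnegative multiple of a point of the unit cube, so its
    coordinate entries lie between 0 and its leading entry.\<close>
  have bnd: "0 \<le> Y cube01 \<alpha>" "0 \<le> Y (ones {i}) \<alpha>" "Y (ones {i}) \<alpha> \<le> Y cube01 \<alpha>"
    if \<alpha>: "\<alpha> \<in> sa_cols d" for \<alpha> i
  proof -
    obtain c x where cx: "hat_of (\<lambda>\<gamma>. Y \<gamma> \<alpha>) = (c, c *\<^sub>R x)" "0 \<le> c" "x \<in> Q"
      using cone[OF \<alpha>] unfolding hcone_def by blast
    have "Y cube01 \<alpha> = c" "Y (ones {i}) \<alpha> = c * x $ i"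
      using cx(1) by (auto simp: hat_of_def vec_eq_iff)
    then show "0 \<le> Y cube01 \<alpha>" "0 \<le> Y (ones {i}) \<alpha>" "Y (ones {i}) \<alpha> \<le> Y cube01 \<alpha>"
      using cx(2) Q01[OF cx(3), of i] by (auto intro: mult_left_le)
  qed

  have "pseudomeasure m I (d + 1)"
  proof
    fix S T :: "'n set" assume ST: "S \<inter> T = {}" "card S + card T \<le> d + 1"
    have "0 \<le> E m (\<lambda>W. of_bool (S \<subseteq> W \<and> W \<inter> T = {}))"
    proof (cases "card S + card T \<le> d")
      case True
      then show ?thesis using key[of "{}" S T] bnd(1)[OF col[of S T d]] ST by simp
    next
      case False
      \<comment> \<open>A cell of \<open>d + 1\<close> literals is too large for a column, so one
        literal is moved to the row: a one directly, a zero as the difference of two rows.\<close>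
      then have c: "card S + card T = d + 1" using ST by simp
      then have "S \<union> T \<noteq> {}" by auto
      then obtain i where "i \<in> S \<union> T" by blast
      then consider "i \<in> S" | "i \<in> T" by blast
      then show ?thesis
      proof cases
        case 1
        have "card (S - {i}) + card T \<le> d" using 1 c card_Suc_Diff1[of S i] by simp
        moreover have "{i} \<union> (S - {i}) = S" using 1 by blast
        moreover have "(S - {i}) \<inter> T = {}" using ST by blast
        ultimately show ?thesis
          using key[of "{i}" "S - {i}" T] bnd(2)[OF col[of "S - {i}" T d], of i] by simp
      next
        case 2
        have cT: "card S + card (T - {i}) \<le> d" using 2 c card_Suc_Diff1[of T i] by simp
        have dT: "S \<inter> (T - {i}) = {}" using ST by blast
        have "E m (\<lambda>W. of_bool (S \<subseteq> W \<and> W \<inter> T = {}))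
          = E m (\<lambda>W. of_bool ({} \<union> S \<subseteq> W \<and> W \<inter> (T - {i}) = {}))
           - E m (\<lambda>W. of_bool ({i} \<union> S \<subseteq> W \<and> W \<inter> (T - {i}) = {}))"
          unfolding E_diff[symmetric] using 2 by (intro arg_cong[where f="E m"] ext) (auto simp: of_bool_def)
        also have "\<dots> = Y cube01 (ones S \<inter> zeros (T - {i})) - Y (ones {i}) (ones S \<inter> zeros (T - {i}))"
          using key[of "{}", OF _ dT cT] key[of "{i}", OF _ dT cT] by simp
        finally show ?thesis using bnd(3)[OF col[OF dT cT], of i] by simp
      qed
    qed
    then show "0 \<le> (\<Sum>X | S \<subseteq> X \<and> X \<inter> T = {}. m X)" by (simp add: E_of_bool)
  qed (use I_down m0 in blast)+
  then show ?thesis using that key by blast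
qed

section \<open>Variables of tiers\<close>

lemma convex_obstruction_relax:
  fixes A :: "real^'n^'m"
  shows "convex (obstruction_relax A b k)"
proof -
  have "convex {x :: real^'n. \<forall>i. (A *v x) $ i \<le> b $ i}"
    by (auto simp: convex_def matrix_vector_right_distrib matrix_vector_mult_scaleR convex_bound_le)
  moreover have "convex {x :: real^'n. \<forall>j. 0 \<le> x $ j \<and> x $ j \<le> 1}"
    by (auto simp: convex_def convex_bound_le)
  moreover have "convex {x :: real^'n. \<forall>O'\<in>obstructions A b k. (\<Sum>i\<in>O'. x $ i) \<le> real (card O') - 1}"
    by (auto simp: convex_def sum.distrib convex_bound_le simp flip: sum_distrib_left)
  ultimately have "convex ({x. \<forall>j. 0 \<le> x $ j \<and> x $ j \<le> 1} \<inter> {x. \<forall>i. (A *v x) $ i \<le> b $ i} \<inter>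
     {x. \<forall>O'\<in>obstructions A b k. (\<Sum>i\<in>O'. x $ i) \<le> real (card O') - 1})"
    by (intro convex_Int)
  moreover have "obstruction_relax A b k = {x. \<forall>j. 0 \<le> x $ j \<and> x $ j \<le> 1} \<inter> {x. \<forall>i. (A *v x) $ i \<le> b $ i} \<inter>
     {x. \<forall>O'\<in>obstructions A b k. (\<Sum>i\<in>O'. x $ i) \<le> real (card O') - 1}"
    by (auto simp: obstruction_relax_def feasible_def)
  ultimately show ?thesis by simp
qed

section \<open>Independent sets of the polytope\<close>

definition indep :: "real^'n^'m \<Rightarrow> real^'m \<Rightarrow> 'n set set" where
  "indep A b = verts (feasible A b)"

text \<open>Rounding \<open>x\<close> down to the indicator of \<open>Z\<close> cannot increase any
  row, because \<open>A\<close> is nonnegative.\<close>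

lemma mem_indepI:
  assumes "\<forall>i j. 0 \<le> A $ i $ j" "x \<in> feasible A b" "\<And>i. i \<in> Z \<Longrightarrow> x $ i = 1"
  shows "Z \<in> indep A b"
proof -
  have le: "ind Z $ j \<le> x $ j" for j
    using assms(2,3) by (cases "j \<in> Z") (auto simp: feasible_def)
  have "(A *v ind Z) $ i \<le> b $ i" for i
  proof -
    have "(A *v ind Z) $ i \<le> (A *v x) $ i"
      unfolding matrix_vector_mult_def using assms(1) le
      by (simp del: ind_nth) (intro sum_mono mult_left_mono, auto)
    then show ?thesis using assms(2) by (auto simp: feasible_def intro: order_trans)
  qed
  then show ?thesis by (auto simp: indep_def verts_def feasible_def)
qed

lemma indep_subset:
  assumes "\<forall>i j. 0 \<le> A $ i $ j" "X \<in> indep A b" "Z \<subseteq> X"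
  shows "Z \<in> indep A b"
proof (rule mem_indepI[OF assms(1)])
  show "ind X \<in> feasible A b" using assms(2) by (simp add: indep_def verts_def)
qed (use assms(3) in auto)

section \<open>Combinatorics of tier variables\<close>

lemma tiers_subset: "S \<in> tiers A b k \<Longrightarrow> S' \<subseteq> S \<Longrightarrow> S' \<in> tiers A b k"
  unfolding tiers_def by blast

lemma tier_var_subset_cube01: "\<alpha> \<in> tier_vars k S \<Longrightarrow> \<alpha> \<subseteq> cube01"
  by (auto simp: tier_vars_def fixed_def)

lemma tier_varE:
  assumes "\<alpha> \<in> tier_vars k S"
  obtains (literals) T where "T \<subseteq> S" "card T \<le> k"
      "\<And>X. X \<in> verts \<alpha> \<longleftrightarrow> S - T \<subseteq> X \<and> X \<inter> T = {}"
    | (counting) T U where "T \<subseteq> S" "U \<subseteq> S" "U \<inter> T = {}" "card T < k" "card U + card T > k"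
      "\<And>X. X \<in> verts \<alpha> \<longleftrightarrow> S - (T \<union> U) \<subseteq> X \<and> X \<inter> T = {} \<and> card (X \<inter> U) < card U - (k - card T)"
  using assms unfolding tier_vars_def by fastforce

text \<open>All literals and the counted set lie inside \<open>S\<close>, so restriction to
  \<open>S\<close> changes nothing.\<close>

lemma verts_tier_var:
  assumes "\<alpha> \<in> tier_vars k S"
  shows "X \<inter> S \<in> verts \<alpha> \<longleftrightarrow> X \<in> verts \<alpha>"
  using assms
proof (cases rule: tier_varE)
  case (literals T)
  then show ?thesis by auto
next
  case (counting T U)
  have "X \<inter> S \<inter> U = X \<inter> U" using counting by blast
  with counting show ?thesis by auto
qed

text \<open>For a counting variable, the witness has as many ones in \<open>U\<close> as the
  threshold allows, which leaves \<open>k - card T + 1\<close> zeros there and \<open>k + 1\<close>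
  in all. Such a vertex bounds the zeros in every other presentation of the variable.\<close>

lemma tier_var_few_zeros:
  assumes "\<alpha> \<in> tier_vars k S"
  obtains X where "X \<in> verts \<alpha>" "X \<subseteq> S" "card (S - X) \<le> k + 1"
  using assms
proof (cases rule: tier_varE)
  case (literals T)
  have "S - (S - T) = T" using literals by blast
  then show ?thesis using literals by (intro that[of "S - T"]) auto
next
  case (counting T U)
  obtain V where V: "V \<subseteq> U" "card V = card U - (k - card T) - 1"
    using obtain_subset_with_card_n[of "card U - (k - card T) - 1" U] by auto
  let ?X = "S - (T \<union> U) \<union> V"
  have XU: "?X \<inter> U = V" using V by blast
  have SX: "S - ?X = T \<union> (U - V)" using V counting by blast
  have "card (S - ?X) \<le> card T + card (U - V)" unfolding SX by (rule card_Un_le)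
  also have "card (U - V) = card U - card V" using V by (intro card_Diff_subset) auto
  finally have "card (S - ?X) \<le> k + 1" using V counting by linarith
  moreover have "?X \<in> verts \<alpha>" using counting V XU by auto
  ultimately show ?thesis using counting V by (intro that[of ?X]) auto
qed

text \<open>The presentation need not be the one that made \<open>\<alpha>\<close> a variable of
  \<open>S'\<close>. Since \<open>S\<close> is a vertex of \<open>\<alpha>\<close> and membership
  sees only the trace on \<open>S'\<close>, that trace already contains \<open>S\<close>.\<close>

lemma tier_var_ones:
  assumes \<alpha>: "\<alpha> \<in> tier_vars k S'" "\<alpha> = ones S \<inter> zeros T \<inter> fewer U r"
    and "S \<inter> T = {}" "S \<inter> U = {}" "0 < r"
  shows "S \<subseteq> S'"
proof -
  have "S \<in> verts \<alpha>" using assms by auto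
  then have "S \<inter> S' \<in> verts \<alpha>" by (simp only: verts_tier_var[OF \<alpha>(1)])
  then show ?thesis using \<alpha>(2) by auto
qed

text \<open>A coordinate that can alter membership must lie in the tier: adding an element of
  \<open>T\<close> to \<open>S\<close> leaves \<open>\<alpha>\<close>, and so does adding an element
  of \<open>U\<close> after \<open>r - 1\<close> others. The bound comes from a vertex with few
  zeros, which vanishes on \<open>T\<close> and on at least \<open>card U + 1 - r\<close> elements
  of \<open>U\<close>.\<close>

lemma tier_var_support:
  assumes \<alpha>: "\<alpha> \<in> tier_vars k S'" "\<alpha> = ones S \<inter> zeros T \<inter> fewer U r"
    and disj: "S \<inter> T = {}" "S \<inter> U = {}" "T \<inter> U = {}" and r: "0 < r" "r \<le> card U"
  shows "S \<subseteq> S'" "T \<subseteq> S'" "U \<subseteq> S'" "card T + (card U + 1 - r) \<le> k + 1"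
proof -
  have tr: "X \<in> verts \<alpha> \<longleftrightarrow> S \<subseteq> X \<and> X \<inter> T = {} \<and> card (X \<inter> U) < r" for X
    using \<alpha>(2) by auto
  note tt = verts_tier_var[OF \<alpha>(1)]
  show S: "S \<subseteq> S'" by (rule tier_var_ones[OF \<alpha> disj(1,2) r(1)])
  show T: "T \<subseteq> S'"
  proof
    fix t assume t: "t \<in> T"
    show "t \<in> S'"
    proof (rule ccontr)
      assume "t \<notin> S'"
      then have "insert t S \<inter> S' = S" using S by blast
      moreover have "S \<in> verts \<alpha>" using tr disj r by auto
      ultimately have "insert t S \<in> verts \<alpha>" using tt[of "insert t S"] by simp
      then show False using tr t by auto
    qed
  qed
  show U: "U \<subseteq> S'"
  proof
    fix u assume u: "u \<in> U"
    have "r - 1 \<le> card (U - {u})" using u r by (simp add: card_Diff_singleton)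
    then obtain C where C: "C \<subseteq> U - {u}" "card C = r - 1"
      using obtain_subset_with_card_n[of "r - 1" "U - {u}"] by auto
    have CU: "(S \<union> C) \<inter> U = C" "insert u (S \<union> C) \<inter> U = insert u C" using C disj u by auto
    have "S \<union> C \<in> verts \<alpha>" unfolding tr CU using C disj r by auto
    moreover have "insert u (S \<union> C) \<notin> verts \<alpha>"
      unfolding tr CU using C r by (subst card_insert_disjoint) auto
    ultimately have "insert u (S \<union> C) \<inter> S' \<noteq> (S \<union> C) \<inter> S'" using tt by metis
    then show "u \<in> S'" by auto
  qed
  obtain X where X: "X \<in> verts \<alpha>" "X \<subseteq> S'" "card (S' - X) \<le> k + 1"
    using tier_var_few_zeros[OF \<alpha>(1)] .
  have "card T + card (U - X) = card (T \<union> (U - X))"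
    using disj by (intro card_Un_disjoint[symmetric]) auto
  also have "\<dots> \<le> card (S' - X)" using X T U by (intro card_mono) (auto simp: tr)
  finally have "card T + card (U - X) \<le> k + 1" using X by simp
  moreover have "card (U - X) = card U - card (X \<inter> U)"
    by (simp add: card_Diff_subset_Int Int_commute)
  ultimately show "card T + (card U + 1 - r) \<le> k + 1" using X(1) unfolding tr by linarith
qed

lemma fewer_1:
  fixes U :: "'n::finite set"
  shows "fewer U 1 = zeros U"
proof -
  have "(\<Sum>i\<in>U. x $ i) \<le> 0 \<longleftrightarrow> (\<forall>i\<in>U. x $ i = 0)" if "x \<in> cube01" for x :: "real^'n"
  proof -
    have nn: "0 \<le> x $ i" for i using that by (auto simp: cube01_def) (metis order_refl zero_le_one)
    then have "(\<Sum>i\<in>U. x $ i) \<ge> 0" by (intro sum_nonneg)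
    then have "(\<Sum>i\<in>U. x $ i) \<le> 0 \<longleftrightarrow> (\<Sum>i\<in>U. x $ i) = 0" by linarith
    then show ?thesis using nn by (simp add: sum_nonneg_eq_0_iff)
  qed
  then show ?thesis by (auto simp: fewer_def fixed_def)
qed

text \<open>Variables with \<open>k + 1\<close> zeros arise from the second kind with threshold \<open>1\<close>.\<close>

lemma literals_in_bz_vars:
  assumes "S \<in> tiers A b k" "X \<union> T \<subseteq> S" "X \<inter> T = {}" "card T \<le> k + 1" "0 < k"
  shows "ones X \<inter> zeros T \<in> bz_vars A b k"
proof -
  have "ones X \<inter> zeros T \<in> tier_vars k (X \<union> T)"
  proof (cases "card T \<le> k")
    case True
    have "X \<union> T - T = X" using assms by blast
    with True show ?thesis unfolding tier_vars_def
      by (intro UnI1 CollectI exI[of _ T]) auto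
  next
    case False
    then have "card T = k + 1" using assms by simp
    then have "fewer T (card T - (k - card {})) = zeros T"
      using fewer_1[of T] by simp
    moreover have "X \<union> T - ({} \<union> T) = X" using assms by blast
    ultimately have "ones X \<inter> zeros T
        = ones (X \<union> T - ({} \<union> T)) \<inter> zeros {} \<inter> fewer T (card T - (k - card {}))"
      by simp
    moreover have "card {} < k" "card T + card {} > k" using assms False by auto
    ultimately show ?thesis unfolding tier_vars_def
      by (intro UnI2 CollectI exI[of _ "{}"] exI[of _ T]) auto
  qed
  then show ?thesis unfolding bz_vars_def using tiers_subset assms by blast
qed

section \<open>Consequences of uselessness\<close>

locale useless_large_tiers =
  fixes A :: "real^'n^'m" and b :: "real^'m" and k l :: nat
  assumes A_nonneg: "\<forall>i j. 0 \<le> A $ i $ j"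
    and k_pos: "0 < k"
    and useless: "\<And>S. S \<in> tiers A b k \<Longrightarrow> l < card S \<Longrightarrow> useless_tier A b k S"
begin

abbreviation "\<I> \<equiv> indep A b"

lemmas indep_down = indep_subset[OF A_nonneg]

text \<open>
  A useless variable either contains no integer point of the polytope or has the same integer points
  of the polytope as a strictly larger variable.
\<close>

lemma bz_var_depends:
  assumes "\<alpha> \<in> bz_vars A b k"
  obtains R where "card R \<le> l" "depends \<I> R (\<lambda>X. X \<in> verts \<alpha>)"
proof -
  have "\<exists>R. card R \<le> l \<and> depends \<I> R (\<lambda>X. X \<in> verts \<alpha>)"
    using assms
  \<comment> \<open>The larger variable may be useless in turn; the induction ends because the
    number of missing vertices drops.\<close>
  proof (induction "card (- verts \<alpha>)" arbitrary: \<alpha> rule: less_induct)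
    case less
    obtain S where S: "S \<in> tiers A b k" "\<alpha> \<in> tier_vars k S"
      using less.prems by (auto simp: bz_vars_def)
    show ?case
    proof (cases "card S \<le> l")
      case True
      then show ?thesis using verts_tier_var[OF S(2)] by (auto simp: depends_def)
    next
      case False
      then have "useless_var (feasible A b) (bz_vars A b k) \<alpha>"
        using useless S by (auto simp: useless_tier_def)
      then obtain \<T> where T: "useless_family (feasible A b) (bz_vars A b k) \<T>" "\<alpha> \<in> \<T>"
        by (auto simp: useless_var_def)
      show ?thesis
      proof (cases "feasible A b \<inter> convex hull \<alpha> = {}")
        case True
        then have "X \<notin> verts \<alpha>" if "X \<in> \<I>" for X
          using that verts_hull[of X \<alpha>] by (auto simp: indep_def verts_def)
        then have "depends \<I> {} (\<lambda>X. X \<in> verts \<alpha>)"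
          using indep_down unfolding depends_def by blast
        then show ?thesis by (intro exI[of _ "{}"]) simp
      next
        case False
        define \<gamma> where "\<gamma> = \<Union>\<T>"
        have \<gamma>: "\<gamma> \<in> bz_vars A b k" "\<gamma> \<notin> \<T>" "\<alpha> \<subseteq> \<gamma>"
          using T by (auto simp: useless_family_def \<gamma>_def)
        have other: "feasible A b \<inter> convex hull T' = {}" if "T' \<in> \<T>" "T' \<noteq> \<alpha>" for T'
          using T that False unfolding useless_family_def by blast
        have same: "X \<in> verts \<alpha> \<longleftrightarrow> X \<in> verts \<gamma>" if "X \<in> \<I>" for X
        proof
          show "X \<in> verts \<alpha> \<Longrightarrow> X \<in> verts \<gamma>" using \<gamma> by (auto simp: verts_def)
          assume "X \<in> verts \<gamma>"
          then obtain T' where T': "T' \<in> \<T>" "X \<in> verts T'" by (auto simp: verts_def \<gamma>_def)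
          have "ind X \<in> feasible A b \<inter> convex hull T'"
            using T' verts_hull \<open>X \<in> \<I>\<close> by (auto simp: indep_def verts_def)
          with other T' show "X \<in> verts \<alpha>" by blast
        qed
        \<comment> \<open>Strict inclusion survives the passage to \<open>verts\<close> because
          \<open>\<gamma>\<close> consists of cube points only.\<close>
        have "\<gamma> \<subseteq> cube01" using \<gamma>(1) tier_var_subset_cube01 by (auto simp: bz_vars_def)
        moreover have "\<alpha> \<subset> \<gamma>" using \<gamma> T(2) by blast
        ultimately have "verts \<alpha> \<subset> verts \<gamma>"
          by (auto simp: verts_def cube01_eq_range_ind)
        then have "card (- verts \<gamma>) < card (- verts \<alpha>)" by (intro psubset_card_mono) auto
        then obtain R where "card R \<le> l" "depends \<I> R (\<lambda>X. X \<in> verts \<gamma>)"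
          using less.hyps \<gamma>(1) by blast
        then show ?thesis using same indep_down unfolding depends_def
          by (metis Int_lower1)
      qed
    qed
  qed
  then show ?thesis using that by blast
qed

text \<open>A set \<open>R\<close> deciding the variable on \<open>\<I>\<close> must contain
  \<open>X\<close> and \<open>T\<close>: the trace of the vertex \<open>X\<close> on
  \<open>R\<close> still contains \<open>X\<close>, and \<open>R\<close> has to tell
  \<open>X\<close> from \<open>insert t X\<close>, which lies outside the variable.\<close>

lemma indep_in_tier_small:
  assumes "S \<in> tiers A b k" "X \<in> \<I>" "X \<union> T \<subseteq> S" "X \<inter> T = {}" "card T \<le> k + 1"
    and ext: "\<And>t. t \<in> T \<Longrightarrow> insert t X \<in> \<I>"
  shows "card X + card T \<le> l"
proof -
  obtain R where R: "card R \<le> l" "depends \<I> R (\<lambda>W. W \<in> verts (ones X \<inter> zeros T))"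
    using bz_var_depends[OF literals_in_bz_vars[OF assms(1,3,4,5) k_pos]] .
  have "X \<subseteq> R" using dependsD[OF R(2) assms(2)] assms(4) by auto
  moreover have "T \<subseteq> R"
  proof
    fix t assume t: "t \<in> T"
    show "t \<in> R"
    proof (rule ccontr)
      assume "t \<notin> R"
      then have "insert t X \<inter> R = X" using \<open>X \<subseteq> R\<close> by blast
      then show False using dependsD[OF R(2) ext[OF t]] t assms(4) by auto
    qed
  qed
  ultimately have "card (X \<union> T) \<le> card R" by (intro card_mono) auto
  then show ?thesis using R(1) assms(4) by (simp add: card_Un_disjoint)
qed

end

section \<open>The lifted matrix\<close>

lemma hat_of_sum: "hat_of (\<lambda>\<alpha>. \<Sum>a\<in>A. f a \<alpha>) = (\<Sum>a\<in>A. hat_of (f a))"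
  by (rule prod_eqI) (simp_all add: hat_of_def fst_sum snd_sum vec_eq_iff sum_component)

text \<open>Cone membership is assumed for cells of at most \<open>l\<close> literals, since a
  column variable decomposes into such cells.\<close>

locale bz_pseudomeasure = useless_large_tiers A b k l + pseudomeasure m "indep A b" "2 * l + 1"
  for A :: "real^'n^'m" and b :: "real^'m" and k l :: nat and m :: "'n set \<Rightarrow> real" +
  assumes cone: "\<And>X T. X \<inter> T = {} \<Longrightarrow> card X + card T \<le> l \<Longrightarrow>
      hat_of (\<lambda>\<gamma>. E m (\<lambda>W. of_bool (W \<in> verts \<gamma> \<and> X \<subseteq> W \<and> W \<inter> T = {})))
        \<in> hcone (obstruction_relax A b k)"
    and relax_nonempty: "obstruction_relax A b k \<noteq> {}"
begin

definition lift :: "(real^'n) set \<Rightarrow> (real^'n) set \<Rightarrow> real" where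
  "lift \<alpha> \<beta> = E m (\<lambda>W. of_bool (W \<in> verts \<alpha> \<and> W \<in> verts \<beta>))"

abbreviation "Vars \<equiv> bz_vars A b k"

lemma lift_eqI:
  assumes "\<And>W. W \<in> \<I> \<Longrightarrow> W \<in> verts \<alpha> \<inter> verts \<beta> \<longleftrightarrow> W \<in> verts \<alpha>' \<inter> verts \<beta>'"
  shows "lift \<alpha> \<beta> = lift \<alpha>' \<beta>'"
  unfolding lift_def using assms by (intro E_cong) simp

lemma lift_null:
  assumes "\<And>W. W \<in> \<I> \<Longrightarrow> W \<in> verts \<alpha> \<Longrightarrow> W \<in> verts \<beta> \<Longrightarrow> False"
  shows "lift \<alpha> \<beta> = 0"
proof -
  have "lift \<alpha> \<beta> = E m (\<lambda>W. 0)" unfolding lift_def using assms by (intro E_cong) auto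
  then show ?thesis by (simp add: E_def)
qed

text \<open>At most \<open>l\<close> coordinates for each variable and one for \<open>P\<close> stay
  within \<open>2 * l + 1\<close>, whatever Boolean combination \<open>F\<close> is taken.\<close>

lemma event_nonneg:
  assumes "\<alpha> \<in> Vars" "\<beta> \<in> Vars" "card C \<le> 1" "depends \<I> C P"
  shows "0 \<le> E m (\<lambda>W. of_bool (F (P W) (W \<in> verts \<alpha>) (W \<in> verts \<beta>)))"
proof -
  obtain R where R: "card R \<le> l" "depends \<I> R (\<lambda>X. X \<in> verts \<alpha>)"
    using bz_var_depends[OF assms(1)] .
  obtain R' where R': "card R' \<le> l" "depends \<I> R' (\<lambda>X. X \<in> verts \<beta>)"
    using bz_var_depends[OF assms(2)] .
  let ?R = "C \<union> R \<union> R'"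
  have "card ?R \<le> 2 * l + 1"
    using card_Un_le[of "C \<union> R" R'] card_Un_le[of C R] assms(3) R(1) R'(1) by linarith
  moreover have "depends \<I> ?R (\<lambda>W. F (P W) (W \<in> verts \<alpha>) (W \<in> verts \<beta>))"
    unfolding depends_def
  proof
    fix W assume W: "W \<in> \<I>"
    have "depends \<I> ?R P" by (rule depends_mono[OF assms(4)]) blast
    moreover have "depends \<I> ?R (\<lambda>X. X \<in> verts \<alpha>)" by (rule depends_mono[OF R(2)]) blast
    moreover have "depends \<I> ?R (\<lambda>X. X \<in> verts \<beta>)" by (rule depends_mono[OF R'(2)]) blast
    ultimately show "F (P W) (W \<in> verts \<alpha>) (W \<in> verts \<beta>)
      = F (P (W \<inter> ?R)) (W \<inter> ?R \<in> verts \<alpha>) (W \<inter> ?R \<in> verts \<beta>)"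
      using dependsD[OF _ W] by metis
  qed
  ultimately show ?thesis by (rule E_nonneg_event)
qed

lemma lift_nonneg: "\<alpha> \<in> Vars \<Longrightarrow> \<beta> \<in> Vars \<Longrightarrow> 0 \<le> lift \<alpha> \<beta>"
  unfolding lift_def
  using event_nonneg[of \<alpha> \<beta> "{}" "\<lambda>_. True" "\<lambda>_ p q. p \<and> q"] by (simp add: depends_def)

text \<open>The difference of the two sides is the measure of an event built from two variables and
  one coordinate; \<open>\<gamma>\<close> will be the cube or a single literal.\<close>

lemma lift_le:
  assumes "\<alpha> \<in> Vars" "\<beta> \<in> Vars" "card C \<le> 1" "depends \<I> C (\<lambda>W. W \<in> verts \<gamma>)"
    and sub: "\<And>W. W \<in> verts \<alpha> \<Longrightarrow> W \<in> verts \<gamma>"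
  shows "lift \<alpha> \<beta> \<le> lift \<gamma> \<beta>"
proof -
  have "lift \<gamma> \<beta> - lift \<alpha> \<beta>
      = E m (\<lambda>W. of_bool (W \<in> verts \<gamma> \<and> W \<notin> verts \<alpha> \<and> W \<in> verts \<beta>))"
    unfolding lift_def E_diff[symmetric]
    by (intro arg_cong[where f="E m"] ext) (use sub in \<open>auto simp: of_bool_def\<close>)
  also have "\<dots> \<ge> 0"
    using event_nonneg[OF assms(1-4), of "\<lambda>p q r. p \<and> \<not> q \<and> r"] by simp
  finally show ?thesis by simp
qed

lemma lift_le_cube01: "\<alpha> \<in> Vars \<Longrightarrow> \<beta> \<in> Vars \<Longrightarrow> lift \<alpha> \<beta> \<le> lift cube01 \<beta>"
  by (rule lift_le[of _ _ "{}"]) (auto simp: depends_def)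

lemma lift_le_ones:
  "\<alpha> \<in> Vars \<Longrightarrow> \<beta> \<in> Vars \<Longrightarrow> (\<And>W. W \<in> verts \<alpha> \<Longrightarrow> i \<in> W) \<Longrightarrow> lift \<alpha> \<beta> \<le> lift (ones {i}) \<beta>"
  by (rule lift_le[of _ _ "{i}"]) (auto simp: depends_def)

lemma lift_le_zeros:
  "\<alpha> \<in> Vars \<Longrightarrow> \<beta> \<in> Vars \<Longrightarrow> (\<And>W. W \<in> verts \<alpha> \<Longrightarrow> i \<notin> W) \<Longrightarrow> lift \<alpha> \<beta> \<le> lift (zeros {i}) \<beta>"
  by (rule lift_le[of _ _ "{i}"]) (auto simp: depends_def)

lemma lift_coord_nonneg:
  assumes "\<beta> \<in> Vars"
  shows "0 \<le> lift (ones {i}) \<beta>" "0 \<le> lift (zeros {i}) \<beta>"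
  unfolding lift_def
  using event_nonneg[OF assms assms, of "{i}" "\<lambda>W. i \<in> W" "\<lambda>p q r. p \<and> r"]
    event_nonneg[OF assms assms, of "{i}" "\<lambda>W. i \<in> W" "\<lambda>p q r. \<not> p \<and> r"]
  by (simp_all add: depends_def)

text \<open>Within \<open>\<I>\<close>, \<open>\<beta>\<close> is a disjoint union of cells on at
  most \<open>l\<close> deciding coordinates, and its column is the sum of theirs, each of which
  lies in the convex cone.\<close>

lemma hat_of_lift_in_hcone:
  assumes "\<beta> \<in> Vars"
  shows "hat_of (\<lambda>\<alpha>. lift \<alpha> \<beta>) \<in> hcone (obstruction_relax A b k)"
proof -
  obtain R where R: "card R \<le> l" "depends \<I> R (\<lambda>X. X \<in> verts \<beta>)"
    using bz_var_depends[OF assms] .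
  let ?f = "\<lambda>V \<alpha>. E m (\<lambda>W. of_bool (W \<in> verts \<alpha> \<and> V \<subseteq> W \<and> W \<inter> (R - V) = {}))"
  have "lift \<alpha> \<beta> = (\<Sum>V\<in>Pow R \<inter> verts \<beta>. ?f V \<alpha>)" for \<alpha>
  proof -
    have "lift \<alpha> \<beta> = (\<Sum>V\<in>Pow R. E m (\<lambda>W. of_bool (W \<inter> R = V) *
        of_bool (W \<in> verts \<alpha> \<and> W \<in> verts \<beta>)))"
      unfolding lift_def by (rule E_split)
    also have "\<dots> = (\<Sum>V\<in>Pow R. if V \<in> verts \<beta> then ?f V \<alpha> else 0)"
    proof (rule sum.cong[OF refl])
      fix V assume V: "V \<in> Pow R"
      have "E m (\<lambda>W. of_bool (W \<inter> R = V) * of_bool (W \<in> verts \<alpha> \<and> W \<in> verts \<beta>))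
          = E m (\<lambda>W. of_bool (V \<in> verts \<beta>) * of_bool (W \<in> verts \<alpha> \<and> V \<subseteq> W \<and> W \<inter> (R - V) = {}))"
      proof (rule E_cong)
        fix W assume "W \<in> \<I>"
        then have "W \<in> verts \<beta> \<longleftrightarrow> W \<inter> R \<in> verts \<beta>" using dependsD[OF R(2)] by blast
        moreover have "W \<inter> R = V \<longleftrightarrow> V \<subseteq> W \<and> W \<inter> (R - V) = {}" using V by blast
        ultimately show "of_bool (W \<inter> R = V) * of_bool (W \<in> verts \<alpha> \<and> W \<in> verts \<beta>)
          = (of_bool (V \<in> verts \<beta>) *
             of_bool (W \<in> verts \<alpha> \<and> V \<subseteq> W \<and> W \<inter> (R - V) = {}) :: real)"
          by (auto simp: of_bool_def)
      qed
      then show "E m (\<lambda>W. of_bool (W \<inter> R = V) * of_bool (W \<in> verts \<alpha> \<and> W \<in> verts \<beta>))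
        = (if V \<in> verts \<beta> then ?f V \<alpha> else 0)"
        by (simp only: E_cmult) simp
    qed
    also have "\<dots> = (\<Sum>V\<in>Pow R \<inter> verts \<beta>. ?f V \<alpha>)"
      by (rule sum.inter_restrict[symmetric]) simp
    finally show ?thesis .
  qed
  then have "hat_of (\<lambda>\<alpha>. lift \<alpha> \<beta>) = (\<Sum>V\<in>Pow R \<inter> verts \<beta>. hat_of (?f V))"
    by (simp only: hat_of_sum)
  also have "\<dots> \<in> hcone (obstruction_relax A b k)"
  proof (rule hcone_sum[OF convex_obstruction_relax relax_nonempty])
    fix V assume "V \<in> Pow R \<inter> verts \<beta>"
    then have "card V + card (R - V) = card R"
      by (metis IntD1 PowD card_Un_disjoint Diff_disjoint Diff_partition finite)
    then show "hat_of (?f V) \<in> hcone (obstruction_relax A b k)"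
      using R(1) by (intro cone) auto
  qed
  finally show ?thesis .
qed

text \<open>Zeros \<open>t\<close> with \<open>insert t X\<close> dependent come for free once
  \<open>X\<close> is present. The remaining cell has at most \<open>l + 1\<close> literals, to
  which \<open>\<beta>\<close> adds at most \<open>l\<close> coordinates.\<close>

lemma tier_cell_nonneg:
  assumes "\<beta> \<in> Vars" "S \<in> tiers A b k" "X \<union> T \<subseteq> S" "X \<inter> T = {}" "card T \<le> k + 2"
  shows "0 \<le> E m (\<lambda>W. of_bool (X \<subseteq> W \<and> W \<inter> T = {} \<and> W \<in> verts \<beta>))"
proof (cases "X \<in> \<I>")
  case False
  then have "E m (\<lambda>W. of_bool (X \<subseteq> W \<and> W \<inter> T = {} \<and> W \<in> verts \<beta>)) = E m (\<lambda>W. 0)"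
    using indep_down by (intro E_cong) auto
  then show ?thesis by (simp add: E_def)
next
  case True
  define T' where "T' = {t \<in> T. insert t X \<in> \<I>}"
  have T': "T' \<subseteq> T" "card T' \<le> k + 2"
    using card_mono[of T T'] assms(5) by (auto simp: T'_def)
  have card: "card X + card T' \<le> l + 1"
  proof (cases "card T' \<le> k + 1")
    case True
    then have "card X + card T' \<le> l"
      using assms T' by (intro indep_in_tier_small[OF assms(2) \<open>X \<in> \<I>\<close>]) (auto simp: T'_def)
    then show ?thesis by simp
  next
    case False
    \<comment> \<open>The smallness bound admits only \<open>k + 1\<close> zeros, so one zero is set
      aside; it takes up the spare coordinate of the degree \<open>2 * l + 1\<close>.\<close>
    then obtain t where t: "t \<in> T'" by force
    have "card X + card (T' - {t}) \<le> l"
      using assms T' t by (intro indep_in_tier_small[OF assms(2) \<open>X \<in> \<I>\<close>]) (auto simp: T'_def)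
    then show ?thesis using card_Suc_Diff1[of T' t] t by simp
  qed
  obtain R where R: "card R \<le> l" "depends \<I> R (\<lambda>X. X \<in> verts \<beta>)"
    using bz_var_depends[OF assms(1)] .
  let ?R = "X \<union> T' \<union> R"
  show ?thesis
  proof (rule E_nonneg_event)
    show "card ?R \<le> 2 * l + 1"
      using card_Un_le[of "X \<union> T'" R] card_Un_le[of X T'] card R(1) by linarith
    have \<beta>: "depends \<I> ?R (\<lambda>X. X \<in> verts \<beta>)" by (rule depends_mono[OF R(2)]) blast
    show "depends \<I> ?R (\<lambda>W. X \<subseteq> W \<and> W \<inter> T = {} \<and> W \<in> verts \<beta>)"
      unfolding depends_def
    proof
      fix W assume W: "W \<in> \<I>"
      have "W \<inter> T = {} \<longleftrightarrow> W \<inter> ?R \<inter> T = {}" if "X \<subseteq> W"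
      proof -
        have "t \<in> T'" if "t \<in> W \<inter> T" for t
        proof -
          have "insert t X \<in> \<I>" using indep_down[OF W] that \<open>X \<subseteq> W\<close> by blast
          with that show ?thesis by (simp add: T'_def)
        qed
        then show ?thesis by blast
      qed
      moreover have "X \<subseteq> W \<longleftrightarrow> X \<subseteq> W \<inter> ?R" by blast
      ultimately show "(X \<subseteq> W \<and> W \<inter> T = {} \<and> W \<in> verts \<beta>)
          = (X \<subseteq> W \<inter> ?R \<and> W \<inter> ?R \<inter> T = {} \<and> W \<inter> ?R \<in> verts \<beta>)"
        using dependsD[OF \<beta> W] by argo
    qed
  qed
qed

text \<open>On \<open>\<alpha>\<close> at least \<open>card U + 1 - r\<close> elements of
  \<open>U\<close> are zero, so this is a Markov inequality for the number of zeros. The signed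
  measure obeys it because only tier cells with at most \<open>k + 2\<close> zeros enter.\<close>

lemma lift_zeros_bound:
  assumes \<beta>: "\<beta> \<in> Vars" and \<alpha>: "\<alpha> \<in> Vars" "\<alpha> = ones S \<inter> zeros T \<inter> fewer U r"
    and disj: "S \<inter> T = {}" "S \<inter> U = {}" "T \<inter> U = {}"
  shows "(real (card U) - (real r - 1)) * lift \<alpha> \<beta> \<le> (\<Sum>i\<in>U. lift (zeros {i}) \<beta>)"
proof -
  have RHS: "0 \<le> (\<Sum>i\<in>U. lift (zeros {i}) \<beta>)"
    by (intro sum_nonneg lift_coord_nonneg \<beta>)
  \<comment> \<open>If \<open>r = 0\<close> the variable has no vertices; if \<open>r\<close>
    exceeds \<open>card U\<close> the coefficient on the left is not positive.\<close>
  consider "r = 0" | "card U < r" | "0 < r" "r \<le> card U" by linarith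
  then show ?thesis
  proof cases
    case 1
    then have "lift \<alpha> \<beta> = 0" using \<alpha>(2) by (intro lift_null) auto
    then show ?thesis using RHS by simp
  next
    case 2
    then have "(real (card U) - (real r - 1)) * lift \<alpha> \<beta> \<le> 0"
      using lift_nonneg[OF \<alpha>(1) \<beta>] by (intro mult_nonpos_nonneg) auto
    then show ?thesis using RHS by linarith
  next
    case 3
    obtain S' where S': "S' \<in> tiers A b k" "\<alpha> \<in> tier_vars k S'"
      using \<alpha>(1) by (auto simp: bz_vars_def)
    note sup = tier_var_support[OF S'(2) \<alpha>(2) disj 3]
    define q where "q = card U + 1 - r"
    have q: "card T + q \<le> k + 1" "0 < q" using sup(4) 3 by (auto simp: q_def)
    define \<gamma> where "\<gamma> = ones S \<inter> zeros T"
    have \<gamma>: "\<gamma> \<in> Vars"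
      unfolding \<gamma>_def using sup S' disj q k_pos by (intro literals_in_bz_vars[of S']) auto
    \<comment> \<open>Under the measure restricted to \<open>\<gamma> \<inter> \<beta>\<close>,
      \<open>\<alpha>\<close> becomes the event of at least \<open>q\<close> zeros in
      \<open>U\<close>.\<close>
    define m' where "m' = (\<lambda>W. m W * of_bool (W \<in> verts \<gamma> \<and> W \<in> verts \<beta>))"
    have Em': "E m' (\<lambda>W. of_bool (P W)) = E m (\<lambda>W. of_bool (P W \<and> W \<in> verts \<gamma> \<and> W \<in> verts \<beta>))" for P
      unfolding E_def m'_def by (rule sum.cong) auto
    have "real q * E m' (\<lambda>W. of_bool (q \<le> card (U - W))) \<le> (\<Sum>i\<in>U. E m' (\<lambda>W. of_bool (i \<notin> W)))"
    proof (rule expected_zeros_lower_bound)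
      fix X Z assume XZ: "X \<subseteq> U" "Z \<subseteq> U" "X \<inter> Z = {}" "card Z \<le> q + 1"
      have "card (T \<union> Z) \<le> k + 2" using card_Un_le[of T Z] XZ(4) q by linarith
      then have "0 \<le> E m (\<lambda>W. of_bool (S \<union> X \<subseteq> W \<and> W \<inter> (T \<union> Z) = {} \<and> W \<in> verts \<beta>))"
        using XZ sup disj by (intro tier_cell_nonneg[OF \<beta> S'(1)]) auto
      also have "\<dots> = E m' (\<lambda>W. of_bool (X \<subseteq> W \<and> W \<inter> Z = {}))"
        unfolding Em' \<gamma>_def by (intro arg_cong[where f="E m"] ext arg_cong[where f=of_bool]) auto
      finally show "0 \<le> E m' (\<lambda>W. of_bool (X \<subseteq> W \<and> W \<inter> Z = {}))" .
    qed
    moreover have "E m' (\<lambda>W. of_bool (q \<le> card (U - W))) = lift \<alpha> \<beta>"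
    proof -
      have "q \<le> card (U - W) \<longleftrightarrow> card (W \<inter> U) < r" for W
      proof -
        have "card (U - W) + card (W \<inter> U) = card U"
          by (metis Int_commute card_Int_Diff add.commute finite)
        then show ?thesis using 3 unfolding q_def by linarith
      qed
      then show ?thesis unfolding Em' lift_def \<alpha>(2) \<gamma>_def
        by (intro arg_cong[where f="E m"] ext arg_cong[where f=of_bool]) auto
    qed
    \<comment> \<open>Lifting the restriction to \<open>\<gamma>\<close> adds the mass of an event
      on one coordinate and two variables, which is nonnegative.\<close>
    moreover have "E m' (\<lambda>W. of_bool (i \<notin> W)) \<le> lift (zeros {i}) \<beta>" for i
    proof -
      have "lift (zeros {i}) \<beta> - E m' (\<lambda>W. of_bool (i \<notin> W))
          = E m (\<lambda>W. of_bool (i \<notin> W \<and> W \<notin> verts \<gamma> \<and> W \<in> verts \<beta>))"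
        unfolding lift_def Em' E_diff[symmetric]
        by (intro arg_cong[where f="E m"] ext) (auto simp: of_bool_def)
      also have "\<dots> \<ge> 0"
        using event_nonneg[OF \<gamma> \<beta>, of "{i}" "\<lambda>W. i \<in> W" "\<lambda>p q r. \<not> p \<and> \<not> q \<and> r"]
        by (simp add: depends_def)
      finally show ?thesis by simp
    qed
    then have "(\<Sum>i\<in>U. E m' (\<lambda>W. of_bool (i \<notin> W))) \<le> (\<Sum>i\<in>U. lift (zeros {i}) \<beta>)"
      by (rule sum_mono)
    moreover have "real q = real (card U) - (real r - 1)" using 3 by (simp add: q_def)
    ultimately show ?thesis by simp
  qed
qed

text \<open>A union bound: off \<open>\<alpha>\<close> some literal fails. The signed measure obeys
  it only for few coordinates, so the literals are first thinned out to at most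
  \<open>l + 1\<close>; the discarded terms are nonnegative.\<close>

lemma lift_union_bound:
  assumes \<beta>: "\<beta> \<in> Vars" and \<alpha>: "\<alpha> \<in> Vars" "\<alpha> = ones S \<inter> zeros T" and disj: "S \<inter> T = {}"
  shows "lift cube01 \<beta> - lift \<alpha> \<beta> \<le> (\<Sum>i\<in>S. lift (zeros {i}) \<beta>) + (\<Sum>i\<in>T. lift (ones {i}) \<beta>)"
proof -
  obtain R where R: "card R \<le> l" "depends \<I> R (\<lambda>X. X \<in> verts \<beta>)"
    using bz_var_depends[OF \<beta>] .
  \<comment> \<open>The union bound for a reduced list of literals, with \<open>l + 1\<close>
    coordinates for them and \<open>\<alpha>\<close> and \<open>l\<close> for
    \<open>\<beta>\<close>. On \<open>\<beta>\<close>, the integrand counts the violated literals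
    and subtracts 1 off \<open>\<alpha>\<close>.\<close>
  have bound: "lift cube01 \<beta> - lift \<alpha> \<beta> \<le> (\<Sum>i\<in>S'. lift (zeros {i}) \<beta>) + (\<Sum>i\<in>T'. lift (ones {i}) \<beta>)"
    if ST: "S' \<union> T' \<subseteq> R'" "card R' \<le> l + 1" and \<alpha>R: "depends \<I> R' (\<lambda>X. X \<in> verts \<alpha>)"
      and miss: "\<And>W. W \<in> \<I> \<Longrightarrow> W \<subseteq> R' \<union> R \<Longrightarrow> W \<notin> verts \<alpha> \<Longrightarrow> (\<exists>i\<in>S'. i \<notin> W) \<or> (\<exists>i\<in>T'. i \<in> W)"
    for S' T' R'
  proof -
    define h :: "'n set \<Rightarrow> real" where "h = (\<lambda>W. of_bool (W \<in> verts \<beta>) *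
      ((\<Sum>i\<in>S'. of_bool (i \<notin> W)) + (\<Sum>i\<in>T'. of_bool (i \<in> W)) - of_bool (W \<notin> verts \<alpha>)))"
    have "0 \<le> E m h"
    proof (rule E_nonneg)
      show "card (R' \<union> R) \<le> 2 * l + 1" using card_Un_le[of R' R] R(1) ST(2) by linarith
      have "depends \<I> (R' \<union> R) (\<lambda>X. X \<in> verts \<beta>)" "depends \<I> (R' \<union> R) (\<lambda>X. X \<in> verts \<alpha>)"
        using depends_mono[OF R(2)] depends_mono[OF \<alpha>R] by blast+
      moreover have "(\<Sum>i\<in>S'. of_bool (i \<notin> W)) = (\<Sum>i\<in>S'. of_bool (i \<notin> W \<inter> (R' \<union> R)) :: real)"
        "(\<Sum>i\<in>T'. of_bool (i \<in> W)) = (\<Sum>i\<in>T'. of_bool (i \<in> W \<inter> (R' \<union> R)) :: real)" for W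
        by (intro sum.cong refl arg_cong[where f=of_bool]; use ST(1) in blast)+
      ultimately show "depends \<I> (R' \<union> R) h"
        unfolding depends_def h_def by presburger
      fix W assume W: "W \<in> \<I>" "W \<subseteq> R' \<union> R"
      show "0 \<le> h W"
      proof (cases "W \<in> verts \<alpha>")
        case True
        then show ?thesis by (auto simp: h_def intro!: add_nonneg_nonneg sum_nonneg)
      next
        case False
        have nn: "0 \<le> (\<Sum>i\<in>S'. of_bool (i \<notin> W) :: real)" "0 \<le> (\<Sum>i\<in>T'. of_bool (i \<in> W) :: real)"
          by (auto intro: sum_nonneg)
        from miss[OF W False] have "1 \<le> (\<Sum>i\<in>S'. of_bool (i \<notin> W)) + (\<Sum>i\<in>T'. of_bool (i \<in> W) :: real)"
        proof
          assume "\<exists>i\<in>S'. i \<notin> W"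
          then obtain i where i: "i \<in> S'" "i \<notin> W" by blast
          then have "of_bool (i \<notin> W) \<le> (\<Sum>i\<in>S'. of_bool (i \<notin> W) :: real)"
            by (intro member_le_sum) auto
          then show ?thesis using i nn by simp
        next
          assume "\<exists>i\<in>T'. i \<in> W"
          then obtain i where i: "i \<in> T'" "i \<in> W" by blast
          then have "of_bool (i \<in> W) \<le> (\<Sum>i\<in>T'. of_bool (i \<in> W) :: real)"
            by (intro member_le_sum) auto
          then show ?thesis using i nn by simp
        qed
        then show ?thesis unfolding h_def by (intro mult_nonneg_nonneg) auto
      qed
    qed
    also have "h = (\<lambda>W. (\<Sum>i\<in>S'. of_bool (W \<in> verts (zeros {i}) \<and> W \<in> verts \<beta>))
        + (\<Sum>i\<in>T'. of_bool (W \<in> verts (ones {i}) \<and> W \<in> verts \<beta>))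
        - (of_bool (W \<in> verts cube01 \<and> W \<in> verts \<beta>) - of_bool (W \<in> verts \<alpha> \<and> W \<in> verts \<beta>)))"
      unfolding h_def by (rule ext) (auto simp: of_bool_def)
    also have "E m \<dots> = (\<Sum>i\<in>S'. lift (zeros {i}) \<beta>) + (\<Sum>i\<in>T'. lift (ones {i}) \<beta>)
        - (lift cube01 \<beta> - lift \<alpha> \<beta>)"
      unfolding lift_def by (simp only: E_diff E_add E_sum)
    finally show ?thesis by simp
  qed
  show ?thesis
  proof (cases "S \<in> \<I>")
    case True
    \<comment> \<open>A deciding set of \<open>\<alpha>\<close> contains \<open>S\<close>, as
      \<open>S\<close> is an independent vertex of \<open>\<alpha>\<close>; among the zeros, those
      inside \<open>R'\<close> suffice.\<close>
    obtain R' where R': "card R' \<le> l" "depends \<I> R' (\<lambda>X. X \<in> verts \<alpha>)"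
      using bz_var_depends[OF \<alpha>(1)] .
    have SR: "S \<subseteq> R'" using dependsD[OF R'(2) True] \<alpha>(2) disj by auto
    have "lift cube01 \<beta> - lift \<alpha> \<beta>
      \<le> (\<Sum>i\<in>S. lift (zeros {i}) \<beta>) + (\<Sum>i\<in>T \<inter> R'. lift (ones {i}) \<beta>)"
    proof (rule bound[OF _ _ R'(2)])
      fix W assume W: "W \<in> \<I>" "W \<notin> verts \<alpha>"
      then have "W \<inter> R' \<notin> verts \<alpha>" using dependsD[OF R'(2) W(1)] by simp
      then show "(\<exists>i\<in>S. i \<notin> W) \<or> (\<exists>i\<in>T \<inter> R'. i \<in> W)" using \<alpha>(2) SR by auto
    qed (use SR R'(1) in auto)
    also have "(\<Sum>i\<in>T \<inter> R'. lift (ones {i}) \<beta>) \<le> (\<Sum>i\<in>T. lift (ones {i}) \<beta>)"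
      by (intro sum_mono2 lift_coord_nonneg \<beta>) auto
    finally show ?thesis by simp
  next
    case False
    obtain S' where S': "S' \<in> tiers A b k" "\<alpha> \<in> tier_vars k S'"
      using \<alpha>(1) by (auto simp: bz_vars_def)
    have "\<alpha> = ones S \<inter> zeros T \<inter> fewer {} 1" unfolding fewer_1 \<alpha>(2) using fixed_subset_cube01 by auto
    then have SS: "S \<subseteq> S'" by (rule tier_var_ones[OF S'(2) _ disj]) auto
    \<comment> \<open>If \<open>S\<close> is dependent, \<open>\<alpha>\<close> contains no
      independent set. A minimal dependent subset \<open>Q\<close> of \<open>S\<close> then
      suffices, since every independent set misses one of its elements.\<close>
    obtain Q where Q: "Q \<subseteq> S" "Q \<notin> \<I>" and min: "\<And>Q'. Q' \<subset> Q \<Longrightarrow> Q' \<in> \<I>"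
    proof -
      have "\<exists>Q\<in>{Q. Q \<subseteq> S \<and> Q \<notin> \<I>}. Q \<subseteq> S \<and>
          (\<forall>Q'\<in>{Q. Q \<subseteq> S \<and> Q \<notin> \<I>}. Q' \<subseteq> Q \<longrightarrow> Q = Q')"
        using False by (intro finite_has_minimal2) auto
      then obtain Q where Q: "Q \<subseteq> S" "Q \<notin> \<I>"
        "\<And>Q'. Q' \<subseteq> S \<Longrightarrow> Q' \<notin> \<I> \<Longrightarrow> Q' \<subseteq> Q \<Longrightarrow> Q = Q'" by auto
      have "Q' \<in> \<I>" if "Q' \<subset> Q" for Q'
        using that Q(1) Q(3)[of Q'] by auto
      with Q(1,2) show ?thesis by (rule that)
    qed
    \<comment> \<open>Removing one element of \<open>Q\<close> leaves an independent set inside the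
      tier, which has at most \<open>l\<close> elements.\<close>
    have cQ: "card Q \<le> l + 1"
    proof (cases "Q = {}")
      case False
      then obtain j where j: "j \<in> Q" by blast
      have "card (Q - {j}) + card ({} :: 'n set) \<le> l"
        using Q SS j by (intro indep_in_tier_small[OF S'(1)] min) auto
      then show ?thesis using card_Suc_Diff1[of Q j] j by simp
    qed simp
    have never: "W \<notin> verts \<alpha>" if "W \<in> \<I>" for W
      using that False indep_down \<alpha>(2) by auto
    have "lift cube01 \<beta> - lift \<alpha> \<beta> \<le> (\<Sum>i\<in>Q. lift (zeros {i}) \<beta>) + (\<Sum>i\<in>{}. lift (ones {i}) \<beta>)"
    proof (rule bound)
      show "depends \<I> Q (\<lambda>X. X \<in> verts \<alpha>)"
        unfolding depends_def using never indep_down[OF _ Int_lower1] by simp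
      fix W assume "W \<in> \<I>"
      then show "(\<exists>i\<in>Q. i \<notin> W) \<or> (\<exists>i\<in>{}. i \<in> W)" using Q(2) indep_down by blast
    qed (use cQ in auto)
    also have "\<dots> \<le> (\<Sum>i\<in>S. lift (zeros {i}) \<beta>) + (\<Sum>i\<in>T. lift (ones {i}) \<beta>)"
      using Q(1) lift_coord_nonneg[OF \<beta>] by (intro add_mono sum_mono2) (simp_all add: sum_nonneg)
    finally show ?thesis .
  qed
qed

section \<open>Linear identities and assembly of the columns\<close>

lemma lift_coord_add: "lift (ones {i}) \<beta> + lift (zeros {i}) \<beta> = lift cube01 \<beta>"
  unfolding lift_def E_add[symmetric]
  by (intro arg_cong[where f="E m"] ext) (auto simp: of_bool_def)

lemma lift_flip:
  assumes "i \<in> T" "S \<inter> T = {}"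
  shows "lift (ones S \<inter> zeros T) \<beta> + lift (ones (S \<union> {i}) \<inter> zeros (T - {i})) \<beta>
      = lift (ones S \<inter> zeros (T - {i})) \<beta>"
  unfolding lift_def E_add[symmetric]
  using assms by (intro arg_cong[where f="E m"] ext) (auto simp: of_bool_def)

text \<open>Each vertex \<open>W\<close> of the cell lies in exactly one refined cell, that of
  \<open>U' = W \<inter> U\<close>; removing those with at least \<open>r\<close> ones leaves the
  counting variable.\<close>

lemma lift_counting:
  assumes "S \<inter> T = {}" "S \<inter> U = {}" "T \<inter> U = {}"
  shows "lift (ones S \<inter> zeros T \<inter> fewer U r) \<beta> = lift (ones S \<inter> zeros T) \<beta>
    - (\<Sum>U'\<in>{U'. U' \<subseteq> U \<and> card U' \<ge> r}. lift (ones (S \<union> U') \<inter> zeros (T \<union> (U - U'))) \<beta>)"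
proof -
  let ?c = "ones S \<inter> zeros T"
  have "of_bool (W \<in> verts (?c \<inter> fewer U r) \<and> W \<in> verts \<beta>) = of_bool (W \<in> verts ?c \<and> W \<in> verts \<beta>)
    - (\<Sum>U'\<in>{U'. U' \<subseteq> U \<and> card U' \<ge> r}.
        of_bool (W \<in> verts (ones (S \<union> U') \<inter> zeros (T \<union> (U - U'))) \<and> W \<in> verts \<beta>) :: real)" for W
  proof -
    have "W \<in> verts (ones (S \<union> U') \<inter> zeros (T \<union> (U - U'))) \<longleftrightarrow> W \<in> verts ?c \<and> U' = W \<inter> U"
      if "U' \<subseteq> U" for U'
      using that by auto
    then have "(\<Sum>U'\<in>{U'. U' \<subseteq> U \<and> card U' \<ge> r}.
        of_bool (W \<in> verts (ones (S \<union> U') \<inter> zeros (T \<union> (U - U'))) \<and> W \<in> verts \<beta>) :: real)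
      = (\<Sum>U'\<in>{U'. U' \<subseteq> U \<and> card U' \<ge> r}.
          if U' = W \<inter> U then of_bool (W \<in> verts ?c \<and> W \<in> verts \<beta>) else 0)"
      by (intro sum.cong) auto
    also have "\<dots> = of_bool (card (W \<inter> U) \<ge> r \<and> W \<in> verts ?c \<and> W \<in> verts \<beta>)"
      by simp
    finally show ?thesis by (auto simp: of_bool_def)
  qed
  then show ?thesis unfolding lift_def E_sum[symmetric] E_diff[symmetric] by presburger
qed

lemma bz_column_lift:
  assumes \<beta>: "\<beta> \<in> Vars"
  shows "bz_column A b k (\<lambda>\<alpha>. lift \<alpha> \<beta>)"
  unfolding bz_column_def
proof (intro conjI ballI allI impI; (elim conjE)?)
  fix \<alpha> assume \<alpha>: "\<alpha> \<in> Vars"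
  show "0 \<le> lift \<alpha> \<beta>" "lift \<alpha> \<beta> \<le> lift cube01 \<beta>"
    using \<alpha> \<beta> by (auto intro: lift_nonneg lift_le_cube01)
  fix S T assume ST: "S \<inter> T = {}" "\<alpha> = ones S \<inter> zeros T"
  show "lift \<alpha> \<beta> \<le> lift (ones {i}) \<beta>" if "i \<in> S" for i
    using \<alpha> \<beta> ST that by (intro lift_le_ones) auto
  show "lift \<alpha> \<beta> \<le> lift (zeros {i}) \<beta>" if "i \<in> T" for i
    using \<alpha> \<beta> ST that by (intro lift_le_zeros) auto
  show "lift \<alpha> \<beta> + lift (ones (S \<union> {i}) \<inter> zeros (T - {i})) \<beta> = lift (ones S \<inter> zeros (T - {i})) \<beta>"
    if "i \<in> T" for i
    using lift_flip[OF that ST(1)] ST(2) by simp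
  \<comment> \<open>Replacing each literal by the complement of its negation turns the bound over
    violated literals into the required one over satisfied literals.\<close>
  have "lift (zeros {i}) \<beta> = lift cube01 \<beta> - lift (ones {i}) \<beta>" for i
    using lift_coord_add[of i \<beta>] by linarith
  then have "(\<Sum>i\<in>S. lift (zeros {i}) \<beta>)
      = real (card S) * lift cube01 \<beta> - (\<Sum>i\<in>S. lift (ones {i}) \<beta>)"
    by (simp add: sum_subtractf)
  moreover have "lift (ones {i}) \<beta> = lift cube01 \<beta> - lift (zeros {i}) \<beta>" for i
    using lift_coord_add[of i \<beta>] by linarith
  then have "(\<Sum>i\<in>T. lift (ones {i}) \<beta>)
      = real (card T) * lift cube01 \<beta> - (\<Sum>i\<in>T. lift (zeros {i}) \<beta>)"
    by (simp add: sum_subtractf)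
  ultimately show "(\<Sum>i\<in>S. lift (ones {i}) \<beta>) + (\<Sum>i\<in>T. lift (zeros {i}) \<beta>) - lift \<alpha> \<beta>
      \<le> (real (card S) + real (card T) - 1) * lift cube01 \<beta>"
    using lift_union_bound[OF \<beta> \<alpha> ST(2,1)] by (simp add: algebra_simps)
next
  fix \<alpha> S T U r
  assume \<alpha>: "\<alpha> \<in> Vars" "\<alpha> = ones S \<inter> zeros T \<inter> fewer U r"
    and disj: "S \<inter> T = {}" "S \<inter> U = {}" "T \<inter> U = {}"
  show "lift \<alpha> \<beta> \<le> lift (ones {i}) \<beta>" if "i \<in> S" for i
    using \<alpha> \<beta> that by (intro lift_le_ones) auto
  show "lift \<alpha> \<beta> \<le> lift (zeros {i}) \<beta>" if "i \<in> T" for i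
    using \<alpha> \<beta> that by (intro lift_le_zeros) auto
  show "(real (card U) - (real r - 1)) * lift \<alpha> \<beta> \<le> (\<Sum>i\<in>U. lift (zeros {i}) \<beta>)"
    by (rule lift_zeros_bound[OF \<beta> \<alpha> disj])
  show "lift \<alpha> \<beta> = lift (ones S \<inter> zeros T) \<beta>
    - (\<Sum>U'\<in>{U'. U' \<subseteq> U \<and> card U' \<ge> r}. lift (ones (S \<union> U') \<inter> zeros (T \<union> (U - U'))) \<beta>)"
    unfolding \<alpha>(2) by (rule lift_counting[OF disj])
qed (use \<beta> in \<open>auto simp: lift_coord_add intro: hat_of_lift_in_hcone\<close>)

end

theorem theorem5:
  fixes A :: "real^'n^'m" and b :: "real^'m" and k l :: nat
  assumes "\<forall>i j. 0 \<le> A $ i $ j"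
    and "\<forall>i. 0 < b $ i"
    and "1 \<le> k"
    and "l \<in> {1..CARD('n)}"
    and "\<forall>S\<in>tiers A b k. l < card S \<longrightarrow> useless_tier A b k S"
  shows "SA (2 * l) (obstruction_relax A b k) \<subseteq> BZ A b k"
proof
  let ?Q = "obstruction_relax A b k"
  fix x assume "x \<in> SA (2 * l) ?Q"
  then obtain Y where Y: "Y \<in> SA_lift (2 * l) ?Q" "hat_of (\<lambda>\<gamma>. Y \<gamma> cube01) = hat x"
    by (auto simp: SA_def)
  have Qf: "?Q \<subseteq> feasible A b" by (auto simp: obstruction_relax_def)
  obtain m where m: "pseudomeasure m (indep A b) (2 * l + 1)"
    and key: "\<And>S X T. card S \<le> 1 \<Longrightarrow> X \<inter> T = {} \<Longrightarrow> card X + card T \<le> 2 * l \<Longrightarrow>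
      Y (ones S) (ones X \<inter> zeros T) = E m (\<lambda>W. of_bool (S \<union> X \<subseteq> W \<and> W \<inter> T = {}))"
  proof (rule SA_lift_pseudomeasure[OF Y(1)])
    show "1 \<le> 2 * l" using assms(4) by simp
    show "0 \<le> y $ j \<and> y $ j \<le> 1" if "y \<in> ?Q" for y j
      using that Qf by (auto simp: feasible_def)
    show "Z \<in> indep A b" if "y \<in> ?Q" "\<And>i. i \<in> Z \<Longrightarrow> y $ i = 1" for y Z
      using that Qf by (intro mem_indepI[OF assms(1)]) auto
    show "Z \<in> indep A b" if "X \<in> indep A b" "Z \<subseteq> X" for X Z
      using indep_subset[OF assms(1) that] .
  qed blast
  have colcone: "hat_of (\<lambda>\<gamma>. Y \<gamma> (ones X \<inter> zeros T)) \<in> hcone ?Q"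
    if "X \<inter> T = {}" "card X + card T \<le> 2 * l" for X T
  proof -
    have "ones X \<inter> zeros T \<in> sa_cols (2 * l)" using that by (auto simp: sa_cols_def)
    then show ?thesis
      using Y(1)[unfolded SA_lift_def mem_Collect_eq, THEN conjunct2, THEN conjunct1] by blast
  qed
  \<comment> \<open>The cone over the empty set is empty, whereas the column of
    \<open>cube01\<close> lies in the cone over \<open>?Q\<close>.\<close>
  have Q: "?Q \<noteq> {}" using colcone[of "{}" "{}"] by (auto simp: hcone_def)
  interpret bz_pseudomeasure A b k l m
  proof (intro bz_pseudomeasure.intro m bz_pseudomeasure_axioms.intro Q)
    show "useless_large_tiers A b k l"
      using assms by unfold_locales auto
    fix X T :: "'n set" assume XT: "X \<inter> T = {}" "card X + card T \<le> l"
    \<comment> \<open>\<open>hat_of\<close> reads only the entries at the cube and at single ones,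
      which are exactly the rows of \<open>Y\<close>.\<close>
    have "hat_of (\<lambda>\<gamma>. E m (\<lambda>W. of_bool (W \<in> verts \<gamma> \<and> X \<subseteq> W \<and> W \<inter> T = {})))
        = hat_of (\<lambda>\<gamma>. Y \<gamma> (ones X \<inter> zeros T))"
      using key[of "{}" X T] key[of "{i}" X T for i] XT by (simp add: hat_of_def vec_eq_iff)
    then show "hat_of (\<lambda>\<gamma>. E m (\<lambda>W. of_bool (W \<in> verts \<gamma> \<and> X \<subseteq> W \<and> W \<inter> T = {}))) \<in> hcone ?Q"
      using colcone[of X T] XT by simp
  qed
  have hat: "hat_of (\<lambda>\<alpha>. lift \<alpha> cube01) = hat x"
    unfolding Y(2)[symmetric] using key[of "{}" "{}" "{}"] key[of "{i}" "{}" "{}" for i]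
    by (simp add: hat_of_def lift_def vec_eq_iff)
  then have one: "lift cube01 cube01 = 1" by (simp add: hat_of_def hat_def)
  have "lift \<in> BZ_lift A b k"
    unfolding BZ_lift_def mem_Collect_eq
  proof (intro conjI ballI impI)
    show "lift \<alpha> \<beta> = lift \<beta> \<alpha>" for \<alpha> \<beta> by (rule lift_eqI) auto
    show "lift \<alpha> \<beta> = 0" if "convex hull \<alpha> \<inter> convex hull \<beta> \<inter> feasible A b = {}" for \<alpha> \<beta>
    proof (rule lift_null)
      fix W assume "W \<in> indep A b" "W \<in> verts \<alpha>" "W \<in> verts \<beta>"
      then have "ind W \<in> convex hull \<alpha> \<inter> convex hull \<beta> \<inter> feasible A b"
        using verts_hull by (auto simp: indep_def verts_def)
      with that show False by blast
    qed
    show "lift \<alpha> \<beta> = lift \<alpha>' \<beta>'" if "\<alpha> \<inter> \<beta> = \<alpha>' \<inter> \<beta>'" for \<alpha> \<beta> \<alpha>' \<beta>'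
      by (rule lift_eqI) (use that in \<open>simp only: verts_Int[symmetric]\<close>)
  qed (use one bz_column_lift in auto)
  with hat show "x \<in> BZ A b k" by (auto simp: BZ_def)
qed

end
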